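(* Let $n\ge3$. Each of the operators $M_{\mathrm{maj}}$, $M_{\mathrm{des}}$ on $\mathbb C[\mathfrak S_n]$ has exactly two nonzero eigenvalues $s_0^{\varepsilon}>0$ and $s_1^{\varepsilon}<0$ ($\varepsilon=\mathrm{maj},\mathrm{des}$), where $$s_0^{\mathrm{maj}}=n!\cdot\frac{n(n-1)}4,\quad s_1^{\mathrm{maj}}=-\frac{n!}2;\qquad s_0^{\mathrm{des}}=n!\cdot\frac{n-1}2,\quad s_1^{\mathrm{des}}=-(n-1)!.$$ The corresponding eigenspaces for both operators coincide. The eigenspace corresponding to $s_0^{\varepsilon}$ is one-dimensional and coincides with the subspace of constants $\mathbb C\cdot\sum_{\sigma\in\mathfrak S_n}\sigma$, i.e., with the subspace of the identity subrepresentation $\pi_{(n)}$ in the left regular representation. The eigenspace corresponding to $s_1^{\varepsilon}$ has dimension $\frac{n(n-1)}2$ and coincides with the subspace $\mathcal H$ (in particular, the subrepresentation of the left regular representation in it is isomorphic to the sum of two irreducible representations $\pi_{(n-1,1)}\oplus\pi_{(n-2,1^2)}$).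
   Context: $\mathfrak S_n$ is the symmetric group on $\{1,\dots,n\}$, with products taken left to right: $(\sigma\tau)(i)=\tau(\sigma(i))$. $\pi_\lambda$ is the irreducible complex representation of $\mathfrak S_n$ corresponding to the Young diagram $\lambda$. For $\sigma\in\mathfrak S_n$: $\mathrm{Des}(\sigma)=\{i\in\{1,\dots,n-1\}:\sigma(i)>\sigma(i+1)\}$, $\mathrm{des}(\sigma)=\#\mathrm{Des}(\sigma)$, $\mathrm{maj}(\sigma)=\sum_{i\in\mathrm{Des}(\sigma)}i$. For $\varepsilon=\mathrm{des},\mathrm{maj}$, $u_\varepsilon=\sum_{g\in\mathfrak S_n}\varepsilon(g)g\in\mathbb C[\mathfrak S_n]$, and $M_\varepsilon$ is the operator of right multiplication by $u_\varepsilon$ in $\mathbb C[\mathfrak S_n]$: $M_\varepsilon f=fu_\varepsilon$, i.e. $(M_\varepsilon f)(\sigma)=\sum_{g\in\mathfrak S_n}f(g)\varepsilon(g^{-1}\sigma)$. For $1\le i<j\le n$ let $e_{ij}=\frac1{\sqrt{n!}}\sum_{\sigma\in\mathfrak S_n}\varepsilon_{ij}(\sigma)\sigma$, where $\varepsilon_{ij}(\sigma)=1$ if $\sigma(i)<\sigma(j)$ and $-1$ if $\sigma(i)>\sigma(j)$; $\mathcal H$ is the linear span of the $e_{ij}$ in $\mathbb C[\mathfrak S_n]$. The left regular representation acts by left multiplication. *)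

theory Defs
  imports
    Complex_Main
    "HOL-Library.Function_Algebras"
    "HOL-Library.Product_Plus"
    "HOL-Combinatorics.Permutations"
begin

section \<open>The symmetric group\<close>

definition Sn :: "nat \<Rightarrow> (nat \<Rightarrow> nat) set" where
  "Sn n = {\<sigma>. \<sigma> permutes {1..n}}"

text \<open>Products of permutations are taken left to right: first \<open>\<sigma>\<close>, then \<open>\<tau>\<close>.\<close>

definition perm_mult :: "(nat \<Rightarrow> nat) \<Rightarrow> (nat \<Rightarrow> nat) \<Rightarrow> nat \<Rightarrow> nat" (infixl "\<cdot>" 70) where
  "\<sigma> \<cdot> \<tau> = (\<lambda>i. \<tau> (\<sigma> i))"

definition Des :: "nat \<Rightarrow> (nat \<Rightarrow> nat) \<Rightarrow> nat set" where
  "Des n \<sigma> = {i \<in> {1..n - 1}. \<sigma> i > \<sigma> (i + 1)}"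

definition des :: "nat \<Rightarrow> (nat \<Rightarrow> nat) \<Rightarrow> nat" where
  "des n \<sigma> = card (Des n \<sigma>)"

definition maj :: "nat \<Rightarrow> (nat \<Rightarrow> nat) \<Rightarrow> nat" where
  "maj n \<sigma> = \<Sum>(Des n \<sigma>)"


section \<open>The group algebra\<close>

text \<open>
  An element \<open>\<Sum>\<^sub>\<sigma> f(\<sigma>) \<sigma>\<close> of the group algebra is represented by its coefficient function,
  extended by zero outside the symmetric group so that equality of functions is
  equality in the algebra. The ambient type is a complex vector space under pointwise
  addition and the scaling below; its pointwise product is not the product of the algebra.
\<close>

definition galg :: "nat \<Rightarrow> ((nat \<Rightarrow> nat) \<Rightarrow> complex) set" where
  "galg n = {f. \<forall>\<sigma>. \<sigma> \<notin> Sn n \<longrightarrow> f \<sigma> = 0}"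

definition fscale :: "complex \<Rightarrow> ('a \<Rightarrow> complex) \<Rightarrow> 'a \<Rightarrow> complex" where
  "fscale c f = (\<lambda>x. c * f x)"

global_interpretation fvs: vector_space "fscale :: complex \<Rightarrow> ('a \<Rightarrow> complex) \<Rightarrow> 'a \<Rightarrow> complex"
  by standard (auto simp: fscale_def algebra_simps)

definition galg_of :: "nat \<Rightarrow> ((nat \<Rightarrow> nat) \<Rightarrow> complex) \<Rightarrow> (nat \<Rightarrow> nat) \<Rightarrow> complex" where
  "galg_of n c = (\<lambda>\<sigma>. if \<sigma> \<in> Sn n then c \<sigma> else 0)"

definition galg_mult ::
  "nat \<Rightarrow> ((nat \<Rightarrow> nat) \<Rightarrow> complex) \<Rightarrow> ((nat \<Rightarrow> nat) \<Rightarrow> complex) \<Rightarrow> (nat \<Rightarrow> nat) \<Rightarrow> complex" where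
  "galg_mult n f h = galg_of n (\<lambda>\<sigma>. \<Sum>g \<in> Sn n. f g * h (inv g \<cdot> \<sigma>))"

definition galg_single :: "nat \<Rightarrow> (nat \<Rightarrow> nat) \<Rightarrow> (nat \<Rightarrow> nat) \<Rightarrow> complex" where
  "galg_single n g = galg_of n (\<lambda>\<sigma>. if \<sigma> = g then 1 else 0)"

definition M_op ::
  "nat \<Rightarrow> ((nat \<Rightarrow> nat) \<Rightarrow> nat) \<Rightarrow> ((nat \<Rightarrow> nat) \<Rightarrow> complex) \<Rightarrow> (nat \<Rightarrow> nat) \<Rightarrow> complex" where
  "M_op n \<epsilon> f = galg_mult n f (galg_of n (\<lambda>g. of_nat (\<epsilon> g)))"

definition eigenspace ::
  "nat \<Rightarrow> (((nat \<Rightarrow> nat) \<Rightarrow> complex) \<Rightarrow> (nat \<Rightarrow> nat) \<Rightarrow> complex) \<Rightarrow> complex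
    \<Rightarrow> ((nat \<Rightarrow> nat) \<Rightarrow> complex) set" where
  "eigenspace n T s = {f \<in> galg n. T f = fscale s f}"

definition is_eigenvalue ::
  "nat \<Rightarrow> (((nat \<Rightarrow> nat) \<Rightarrow> complex) \<Rightarrow> (nat \<Rightarrow> nat) \<Rightarrow> complex) \<Rightarrow> complex \<Rightarrow> bool" where
  "is_eigenvalue n T s \<longleftrightarrow> (\<exists>f \<in> eigenspace n T s. f \<noteq> 0)"

definition e_vec :: "nat \<Rightarrow> nat \<Rightarrow> nat \<Rightarrow> (nat \<Rightarrow> nat) \<Rightarrow> complex" where
  "e_vec n i j = fscale (complex_of_real (1 / sqrt (fact n)))
     (galg_of n (\<lambda>\<sigma>. if \<sigma> i < \<sigma> j then 1 else - 1))"

definition H_space :: "nat \<Rightarrow> ((nat \<Rightarrow> nat) \<Rightarrow> complex) set" where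
  "H_space n = fvs.span {e_vec n i j | i j. 1 \<le> i \<and> i < j \<and> j \<le> n}"


section \<open>Complex representations of the symmetric group\<close>

text \<open>
  A representation is given by its underlying space (a subset of an additive group type),
  its complex scaling, and the action of the permutations.
\<close>

record 'v crep =
  rep_space :: "'v set"
  rep_scale :: "complex \<Rightarrow> 'v \<Rightarrow> 'v"
  rep_act :: "(nat \<Rightarrow> nat) \<Rightarrow> 'v \<Rightarrow> 'v"

definition invariant_subspace :: "nat \<Rightarrow> 'v::ab_group_add crep \<Rightarrow> 'v set \<Rightarrow> bool" where
  "invariant_subspace n R U \<longleftrightarrow>
     U \<subseteq> rep_space R \<and> 0 \<in> U \<and>
     (\<forall>x \<in> U. \<forall>y \<in> U. x + y \<in> U) \<and>
     (\<forall>c. \<forall>x \<in> U. rep_scale R c x \<in> U) \<and>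
     (\<forall>g \<in> Sn n. \<forall>x \<in> U. rep_act R g x \<in> U)"

definition subrep :: "'v crep \<Rightarrow> 'v set \<Rightarrow> 'v crep" where
  "subrep R U = R\<lparr>rep_space := U\<rparr>"

definition irreducible_rep :: "nat \<Rightarrow> 'v::ab_group_add crep \<Rightarrow> bool" where
  "irreducible_rep n R \<longleftrightarrow>
     invariant_subspace n R (rep_space R) \<and> rep_space R \<noteq> {0} \<and>
     (\<forall>U. invariant_subspace n R U \<longrightarrow> U = {0} \<or> U = rep_space R)"

definition rep_iso :: "nat \<Rightarrow> 'v::ab_group_add crep \<Rightarrow> 'w::ab_group_add crep \<Rightarrow> bool" where
  "rep_iso n R R' \<longleftrightarrow> (\<exists>T. bij_betw T (rep_space R) (rep_space R') \<and>
     (\<forall>x \<in> rep_space R. \<forall>y \<in> rep_space R. T (x + y) = T x + T y) \<and>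
     (\<forall>c. \<forall>x \<in> rep_space R. T (rep_scale R c x) = rep_scale R' c (T x)) \<and>
     (\<forall>g \<in> Sn n. \<forall>x \<in> rep_space R. T (rep_act R g x) = rep_act R' g (T x)))"

definition rep_sum :: "'v crep \<Rightarrow> 'w crep \<Rightarrow> ('v \<times> 'w) crep" where
  "rep_sum R R' =
     \<lparr>rep_space = rep_space R \<times> rep_space R',
      rep_scale = (\<lambda>c (x, y). (rep_scale R c x, rep_scale R' c y)),
      rep_act = (\<lambda>g (x, y). (rep_act R g x, rep_act R' g y))\<rparr>"

definition left_regular :: "nat \<Rightarrow> ((nat \<Rightarrow> nat) \<Rightarrow> complex) crep" where
  "left_regular n =
     \<lparr>rep_space = galg n,
      rep_scale = fscale,
      rep_act = (\<lambda>g f. galg_mult n (galg_single n g) f)\<rparr>"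


section \<open>The representation attached to a Young diagram\<close>

text \<open>
  A Young diagram with \<open>n\<close> cells is given by the list \<open>l\<close> of its row lengths (weakly
  decreasing, with sum \<open>n\<close>). Its cells are numbered \<open>1, \<dots>, n\<close> along the rows, from top to
  bottom; \<open>row_of l k\<close> (counted from 0) and \<open>col_of l k\<close> (counted from 1) locate the cell
  number \<open>k\<close>.
\<close>

definition row_of :: "nat list \<Rightarrow> nat \<Rightarrow> nat" where
  "row_of l k = (LEAST r. k \<le> sum_list (take (Suc r) l))"

definition col_of :: "nat list \<Rightarrow> nat \<Rightarrow> nat" where
  "col_of l k = k - sum_list (take (row_of l k) l)"

definition row_group :: "nat \<Rightarrow> nat list \<Rightarrow> (nat \<Rightarrow> nat) set" where
  "row_group n l = {p \<in> Sn n. \<forall>k \<in> {1..n}. row_of l (p k) = row_of l k}"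

definition col_group :: "nat \<Rightarrow> nat list \<Rightarrow> (nat \<Rightarrow> nat) set" where
  "col_group n l = {p \<in> Sn n. \<forall>k \<in> {1..n}. col_of l (p k) = col_of l k}"

definition young_symmetrizer :: "nat \<Rightarrow> nat list \<Rightarrow> (nat \<Rightarrow> nat) \<Rightarrow> complex" where
  "young_symmetrizer n l = galg_mult n
     (galg_of n (\<lambda>p. if p \<in> row_group n l then 1 else 0))
     (galg_of n (\<lambda>p. if p \<in> col_group n l then of_int (sign p) else 0))"

text \<open>
  The irreducible representation of the diagram is the left ideal generated by its Young
  symmetrizer. One row gives the trivial representation, one column the sign representation.
\<close>

definition young_rep :: "nat \<Rightarrow> nat list \<Rightarrow> ((nat \<Rightarrow> nat) \<Rightarrow> complex) crep" where
  "young_rep n l =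
     subrep (left_regular n) ((\<lambda>f. galg_mult n f (young_symmetrizer n l)) ` galg n)"

end

theory Submission
  imports Defs
begin

text \<open>
  Writing \<open>\<epsilon>(\<sigma>) = \<Sum>\<^sub>i w\<^sub>i [\<sigma>(i) > \<sigma>(i + 1)]\<close> with weights \<open>w\<^sub>i = 1\<close> for \<open>des\<close> and \<open>w\<^sub>i = i\<close> for \<open>maj\<close>,
  each bracket is \<open>(1 - sgn(\<sigma>(i + 1) - \<sigma>(i))) / 2\<close>, so right multiplication by \<open>u\<^sub>\<epsilon>\<close> maps into the sum
  of the constants and \<open>\<H>\<close>. Pairing \<open>g\<close> with \<open>(i i+1) \<circ> g\<close> shows that each \<open>e\<^sub>i\<^sub>j\<close> is an eigenvector
  with eigenvalue \<open>- (n - 2)! \<Sum> w\<^sub>i\<close>, and the constants are orthogonal to \<open>\<H>\<close>.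

  For the representations, \<open>\<H>\<close> and the two left ideals are all spaces of functions
  \<open>\<sigma> \<mapsto> \<Sum>\<^sub>i\<^sub>j c\<^sub>i\<^sub>j \<kappa>(\<sigma>(i), \<sigma>(j))\<close> for an antisymmetric kernel \<open>\<kappa>\<close>: the sign of the difference, the
  difference of \<open>[x = n] - [x = 1]\<close>, and the alternating function supported on \<open>{1, n - 1, n}\<close>. A
  coefficient array \<open>c\<close> gives zero for the first kernel iff it is symmetric, iff it gives zero for
  both others, so sending the first function to the pair of the others is the required isomorphism.
\<close>

declare One_nat_def [simp del]

section \<open>Permutations and coefficient functions\<close>

lemma sum_fun_apply: "(\<Sum>a\<in>A. f a) x = (\<Sum>a\<in>A. f a x :: complex)"
  by (induction A rule: infinite_finite_induct) auto

lemma perm_mult_comp: "\<sigma> \<cdot> \<tau> = \<tau> \<circ> \<sigma>"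
  by (auto simp: perm_mult_def)

lemma finite_Sn [simp]: "finite (Sn n)"
  by (simp add: Sn_def finite_permutations)

lemma id_in_Sn [simp]: "id \<in> Sn n"
  by (simp add: Sn_def permutes_id)

lemma inv_in_Sn [simp]: "\<sigma> \<in> Sn n \<Longrightarrow> inv \<sigma> \<in> Sn n"
  by (simp add: Sn_def permutes_inv)

lemma comp_in_Sn [simp]: "\<sigma> \<in> Sn n \<Longrightarrow> \<tau> \<in> Sn n \<Longrightarrow> \<sigma> \<circ> \<tau> \<in> Sn n"
  by (simp add: Sn_def permutes_compose)

lemma transpose_in_Sn [simp]: "a \<in> {1..n} \<Longrightarrow> b \<in> {1..n} \<Longrightarrow> transpose a b \<in> Sn n"
  unfolding Sn_def mem_Collect_eq by (rule permutes_swap_id)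

lemma Sn_apply_in: "\<sigma> \<in> Sn n \<Longrightarrow> \<sigma> i \<in> {1..n} \<longleftrightarrow> i \<in> {1..n}"
  unfolding Sn_def mem_Collect_eq by (rule permutes_in_image)

lemma Sn_inj: "\<sigma> \<in> Sn n \<Longrightarrow> \<sigma> i = \<sigma> j \<longleftrightarrow> i = j"
  unfolding Sn_def mem_Collect_eq by (metis permutes_inj inj_eq)

lemma Sn_inv_apply [simp]: "\<sigma> \<in> Sn n \<Longrightarrow> inv \<sigma> (\<sigma> i) = i" "\<sigma> \<in> Sn n \<Longrightarrow> \<sigma> (inv \<sigma> i) = i"
  by (auto simp: Sn_def permutes_inverses)

lemma Sn_inv_comp:
  assumes "\<sigma> \<in> Sn n" "\<tau> \<in> Sn n"
  shows "inv (\<sigma> \<circ> \<tau>) = inv \<tau> \<circ> inv \<sigma>"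
  using assms by (auto simp: Sn_def o_inv_distrib permutes_bij)

lemma Sn_inv_inv [simp]: "\<sigma> \<in> Sn n \<Longrightarrow> inv (inv \<sigma>) = \<sigma>"
  by (simp add: Sn_def permutes_inv_inv)

lemma Sn_comp_inv [simp]: "\<sigma> \<in> Sn n \<Longrightarrow> \<sigma> \<circ> inv \<sigma> = id" "\<sigma> \<in> Sn n \<Longrightarrow> inv \<sigma> \<circ> \<sigma> = id"
  by (auto simp: fun_eq_iff)

lemma sum_Sn_comp_left: "t \<in> Sn n \<Longrightarrow> (\<Sum>g\<in>Sn n. F (t \<circ> g)) = (\<Sum>g\<in>Sn n. F g)"
  by (rule sum.reindex_bij_witness [where i = "\<lambda>g. inv t \<circ> g" and j = "\<lambda>g. t \<circ> g"])
    (simp_all flip: comp_assoc)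

lemma sum_Sn_comp_right: "t \<in> Sn n \<Longrightarrow> (\<Sum>g\<in>Sn n. F (g \<circ> t)) = (\<Sum>g\<in>Sn n. F g)"
  by (rule sum.reindex_bij_witness [where i = "\<lambda>g. g \<circ> inv t" and j = "\<lambda>g. g \<circ> t"])
    (simp_all add: comp_assoc)

lemma sum_Sn_inv: "(\<Sum>g\<in>Sn n. F (inv g)) = (\<Sum>g\<in>Sn n. F g)"
  unfolding Sn_def by (rule sum_permutations_inverse [symmetric])

lemma sum_Sn_reindex: "g \<in> Sn n \<Longrightarrow> (\<Sum>i\<in>{1..n}. F (g i)) = (\<Sum>i\<in>{1..n}. F i)"
  by (rule sum.reindex_bij_betw) (simp add: Sn_def permutes_imp_bij)

lemma card_Sn [simp]: "card (Sn n) = fact n"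
  using card_permutations [of "{1..n}" n] by (simp add: Sn_def)

text \<open>Triple transitivity. Three transpositions in turn send \<open>a\<close>,
  \<open>b\<close>, \<open>c\<close> to their targets; a later one leaves the targets already
  reached alone, because injectivity keeps the next point away from them.\<close>

lemma Sn_with_three_values:
  assumes "a \<in> {1..n}" "b \<in> {1..n}" "c \<in> {1..n}" "x \<in> {1..n}" "y \<in> {1..n}" "z \<in> {1..n}"
    and "distinct [a, b, c]" "distinct [x, y, z]"
  shows "\<exists>\<sigma>\<in>Sn n. \<sigma> a = x \<and> \<sigma> b = y \<and> \<sigma> c = z"
proof -
  define s1 where "s1 = transpose a x"
  define s2 where "s2 = transpose (s1 b) y \<circ> s1"
  define s3 where "s3 = transpose (s2 c) z \<circ> s2"
  have s1: "s1 \<in> Sn n" "s1 a = x"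
    using assms by (auto simp: s1_def)
  have s2: "s2 \<in> Sn n" "s2 b = y"
    using assms s1 Sn_apply_in [OF s1(1)] by (simp_all add: s2_def comp_in_Sn)
  have s1b: "s1 b \<noteq> x"
    using s1 assms by (metis Sn_inj distinct_length_2_or_more)
  have s2a: "s2 a = x"
    using assms s1 s1b by (simp add: s2_def transpose_def)
  have s2c: "s2 c \<noteq> x" "s2 c \<noteq> y"
    using s2 s2a assms by (metis Sn_inj distinct_length_2_or_more)+
  have "s3 \<in> Sn n" "s3 c = z"
    using assms s2 Sn_apply_in [OF s2(1)] by (simp_all add: s3_def comp_in_Sn)
  moreover have "s3 a = x" "s3 b = y"
    using assms s2 s2a s2c by (simp_all add: s3_def transpose_def)
  ultimately show ?thesis
    by blast
qed

text \<open>A spare point on each side, available since \<open>n \<ge> 3\<close>, reduces this to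
  three prescribed values.\<close>

lemma Sn_with_two_values:
  assumes "n \<ge> 3" "a \<in> {1..n}" "b \<in> {1..n}" "x \<in> {1..n}" "y \<in> {1..n}" "a \<noteq> b" "x \<noteq> y"
  shows "\<exists>\<sigma>\<in>Sn n. \<sigma> a = x \<and> \<sigma> b = y"
proof -
  have third: "\<exists>c\<in>{1..n}. c \<noteq> u \<and> c \<noteq> v" for u v
  proof -
    have "card ({1..n} - {u, v}) \<ge> card {1..n} - card {u, v}"
      by (rule diff_card_le_card_Diff) simp
    moreover have "card {u, v} \<le> 2"
      by (simp add: card_insert_if)
    ultimately have "card ({1..n} - {u, v}) > 0"
      using assms(1) by simp
    then have "{1..n} - {u, v} \<noteq> {}"
      by (metis card.empty less_irrefl)
    then show ?thesis
      by blast
  qed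
  obtain c z where "c \<in> {1..n}" "c \<noteq> a" "c \<noteq> b" "z \<in> {1..n}" "z \<noteq> x" "z \<noteq> y"
    using third by meson
  with Sn_with_three_values [of a n b c x y z] assms show ?thesis
    by auto
qed

text \<open>Once one solution \<open>h\<close> is fixed, all of them are \<open>h \<circ> p\<close>
  with \<open>p\<close> in the pointwise stabilizer of \<open>a\<close> and \<open>b\<close>, which
  is the symmetric group on the remaining \<open>n - 2\<close> points.\<close>

lemma card_Sn_two_values:
  assumes "n \<ge> 3" "a \<in> {1..n}" "b \<in> {1..n}" "x \<in> {1..n}" "y \<in> {1..n}" "a \<noteq> b" "x \<noteq> y"
  shows "card {g \<in> Sn n. g a = x \<and> g b = y} = fact (n - 2)"
proof -
  obtain h where h: "h \<in> Sn n" "h a = x" "h b = y"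
    using Sn_with_two_values assms by metis
  have stab: "p permutes {1..n} - {a, b} \<longleftrightarrow> p \<in> Sn n \<and> p a = a \<and> p b = b" for p
  proof
    assume p: "p permutes {1..n} - {a, b}"
    then have "p permutes {1..n}"
      by (rule permutes_subset) auto
    with p show "p \<in> Sn n \<and> p a = a \<and> p b = b"
      by (auto simp: Sn_def intro: permutes_not_in)
  next
    assume "p \<in> Sn n \<and> p a = a \<and> p b = b"
    then have "p permutes {1..n}" "\<And>x. x \<in> {1..n} - ({1..n} - {a, b}) \<Longrightarrow> p x = x"
      by (auto simp: Sn_def)
    then show "p permutes {1..n} - {a, b}"
      by (rule permutes_superset)
  qed
  have "bij_betw (\<lambda>p. h \<circ> p) {p. p permutes {1..n} - {a, b}} {g \<in> Sn n. g a = x \<and> g b = y}"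
  proof (rule bij_betwI [where g = "\<lambda>p. inv h \<circ> p"])
    show "(\<lambda>p. h \<circ> p) \<in> {p. p permutes {1..n} - {a, b}} \<rightarrow> {g \<in> Sn n. g a = x \<and> g b = y}"
      using h by (auto simp: stab)
    show "(\<lambda>p. inv h \<circ> p) \<in> {g \<in> Sn n. g a = x \<and> g b = y} \<rightarrow> {p. p permutes {1..n} - {a, b}}"
      using h by (auto simp: stab)
    show "inv h \<circ> (h \<circ> p) = p" "h \<circ> (inv h \<circ> p) = p" for p
      using h by (simp_all flip: comp_assoc)
  qed
  then have "card {g \<in> Sn n. g a = x \<and> g b = y} = card {p. p permutes {1..n} - {a, b}}"
    by (simp add: bij_betw_same_card)
  also have "\<dots> = fact (n - 2)"
    using assms by (intro card_permutations) (auto simp: card_Diff_subset)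
  finally show ?thesis .
qed

section \<open>Coefficient functions, the regular action and left ideals\<close>

lemma galg_of_apply [simp]: "\<sigma> \<in> Sn n \<Longrightarrow> galg_of n f \<sigma> = f \<sigma>"
  by (simp add: galg_of_def)

lemma galg_of_in_galg [simp]: "galg_of n f \<in> galg n"
  by (simp add: galg_of_def galg_def)

lemma galg_of_eq_iff: "galg_of n f = galg_of n h \<longleftrightarrow> (\<forall>\<sigma>\<in>Sn n. f \<sigma> = h \<sigma>)"
  by (auto simp: galg_of_def fun_eq_iff)

lemma galg_of_id: "f \<in> galg n \<Longrightarrow> galg_of n f = f"
  by (auto simp: galg_of_def galg_def fun_eq_iff)

lemma galg_of_add: "galg_of n f + galg_of n h = galg_of n (\<lambda>\<sigma>. f \<sigma> + h \<sigma>)"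
  by (auto simp: galg_of_def fun_eq_iff)

lemma galg_of_diff: "galg_of n f - galg_of n h = galg_of n (\<lambda>\<sigma>. f \<sigma> - h \<sigma>)"
  by (auto simp: galg_of_def fun_eq_iff)

lemma galg_of_scale: "fscale c (galg_of n f) = galg_of n (\<lambda>\<sigma>. c * f \<sigma>)"
  by (auto simp: galg_of_def fscale_def fun_eq_iff)

lemma galg_of_sum: "(\<Sum>a\<in>A. galg_of n (f a)) = galg_of n (\<lambda>\<sigma>. \<Sum>a\<in>A. f a \<sigma>)"
  by (auto simp: galg_of_def fun_eq_iff sum_fun_apply)

lemma galg_of_zero: "galg_of n (\<lambda>\<sigma>. 0) = 0"
  by (auto simp: galg_of_def fun_eq_iff)

lemma subspace_galg: "fvs.subspace (galg n)"
  by (auto simp: fvs.subspace_def galg_def fscale_def)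

lemma galg_mult_expand:
  "galg_mult n f h = (\<Sum>g\<in>Sn n. fscale (f g) (galg_of n (\<lambda>\<sigma>. h (inv g \<cdot> \<sigma>))))"
  by (simp add: galg_of_scale galg_of_sum galg_mult_def)

lemma galg_mult_single:
  assumes "g \<in> Sn n"
  shows "galg_mult n (galg_single n g) f = galg_of n (\<lambda>\<sigma>. f (inv g \<cdot> \<sigma>))"
proof -
  have "(\<Sum>h\<in>Sn n. galg_single n g h * f (inv h \<cdot> \<sigma>)) = f (inv g \<cdot> \<sigma>)" for \<sigma>
  proof -
    have "(\<Sum>h\<in>Sn n. galg_single n g h * f (inv h \<cdot> \<sigma>))
        = (\<Sum>h\<in>Sn n. if h = g then f (inv h \<cdot> \<sigma>) else 0)"
      by (rule sum.cong) (auto simp: galg_single_def)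
    then show ?thesis
      using assms by simp
  qed
  then show ?thesis
    by (simp add: galg_mult_def)
qed

lemma left_regular_simps [simp]:
  "rep_space (subrep (left_regular n) W) = W"
  "rep_space (left_regular n) = galg n"
  "rep_scale (left_regular n) = fscale"
  "rep_scale (subrep (left_regular n) W) = fscale"
  "rep_act (subrep (left_regular n) W) g f = rep_act (left_regular n) g f"
  by (auto simp: subrep_def left_regular_def)

text \<open>Since products are read left to right, \<open>inv g \<cdot> \<sigma>\<close> is
  \<open>\<sigma> \<circ> inv g\<close>: left multiplication permutes the positions of
  \<open>\<sigma>\<close> and leaves its values alone.\<close>

lemma left_regular_act:
  "g \<in> Sn n \<Longrightarrow> rep_act (left_regular n) g f = galg_of n (\<lambda>\<sigma>. f (\<sigma> \<circ> inv g))"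
  by (simp add: left_regular_def galg_mult_single perm_mult_comp)

text \<open>The product of \<open>f\<close> and \<open>h\<close> is the sum of the left translates
  of \<open>h\<close> weighted by the \<open>f g\<close>, and multiplying by a single group element
  gives each translate itself.\<close>

lemma left_ideal_eq_span:
  "(\<lambda>f. galg_mult n f h) ` galg n = fvs.span ((\<lambda>g. galg_of n (\<lambda>\<sigma>. h (\<sigma> \<circ> inv g))) ` Sn n)"
    (is "?A = fvs.span ?B")
proof
  show "?A \<subseteq> fvs.span ?B"
  proof
    fix x
    assume "x \<in> ?A"
    then obtain f where "x = galg_mult n f h"
      by auto
    then have x: "x = (\<Sum>g\<in>Sn n. fscale (f g) (galg_of n (\<lambda>\<sigma>. h (\<sigma> \<circ> inv g))))"
      by (simp add: galg_mult_expand perm_mult_comp)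
    show "x \<in> fvs.span ?B"
      unfolding x by (intro fvs.span_sum fvs.span_scale fvs.span_base) auto
  qed
  have "fvs.subspace ?A"
    unfolding fvs.subspace_def
  proof (intro conjI ballI allI)
    have "0 = galg_mult n 0 h"
      by (auto simp: galg_mult_def galg_of_def)
    then show "0 \<in> ?A"
      using fvs.subspace_0 [OF subspace_galg] by auto
  next
    fix x y
    assume "x \<in> ?A" "y \<in> ?A"
    then obtain f f' where f: "f \<in> galg n" "f' \<in> galg n" "x = galg_mult n f h" "y = galg_mult n f' h"
      by auto
    then have "x + y = galg_mult n (f + f') h"
      by (simp add: galg_mult_def galg_of_add sum.distrib algebra_simps)
    then show "x + y \<in> ?A"
      using f fvs.subspace_add [OF subspace_galg] by auto
  next
    fix c x
    assume "x \<in> ?A"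
    then obtain f where f: "f \<in> galg n" "x = galg_mult n f h"
      by auto
    then have "fscale c x = galg_mult n (fscale c f) h"
      unfolding f galg_mult_def galg_of_scale
      by (simp add: sum_distrib_left fscale_def algebra_simps)
    then show "fscale c x \<in> ?A"
      using f fvs.subspace_scale [OF subspace_galg] by auto
  qed
  moreover have "?B \<subseteq> ?A"
  proof
    fix x
    assume "x \<in> ?B"
    then obtain g where "g \<in> Sn n" "x = galg_of n (\<lambda>\<sigma>. h (\<sigma> \<circ> inv g))"
      by auto
    then have "x = galg_mult n (galg_single n g) h"
      by (simp add: galg_mult_single perm_mult_comp)
    moreover have "galg_single n g \<in> galg n"
      by (simp add: galg_single_def)
    ultimately show "x \<in> ?A"
      by blast
  qed
  ultimately show "fvs.span ?B \<subseteq> ?A"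
    by (simp add: fvs.span_minimal)
qed

section \<open>Combinations of a kernel\<close>

text \<open>The coefficients \<open>c\<close> refer to positions and the kernel
  \<open>\<kappa>\<close> to values. The left action touches positions only, so it merely relabels
  \<open>c\<close>.\<close>

definition kernel_sum ::
  "nat \<Rightarrow> (nat \<Rightarrow> nat \<Rightarrow> complex) \<Rightarrow> (nat \<Rightarrow> nat \<Rightarrow> complex) \<Rightarrow> (nat \<Rightarrow> nat) \<Rightarrow> complex" where
  "kernel_sum n \<kappa> c = galg_of n (\<lambda>\<sigma>. \<Sum>i\<in>{1..n}. \<Sum>j\<in>{1..n}. c i j * \<kappa> (\<sigma> i) (\<sigma> j))"

definition kernel_gen ::
  "nat \<Rightarrow> (nat \<Rightarrow> nat \<Rightarrow> complex) \<Rightarrow> nat \<Rightarrow> nat \<Rightarrow> (nat \<Rightarrow> nat) \<Rightarrow> complex" where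
  "kernel_gen n \<kappa> a b = galg_of n (\<lambda>\<sigma>. \<kappa> (\<sigma> a) (\<sigma> b))"

lemma sum_sum_delta:
  fixes F :: "nat \<Rightarrow> nat \<Rightarrow> complex"
  assumes "a \<in> {1..n}" "b \<in> {1..n}"
  shows "(\<Sum>i\<in>{1..n}. \<Sum>j\<in>{1..n}. F i j * of_bool (i = a \<and> j = b)) = F a b"
proof -
  have "(\<Sum>i\<in>{1..n}. \<Sum>j\<in>{1..n}. F i j * of_bool (i = a \<and> j = b))
      = (\<Sum>i\<in>{1..n}. \<Sum>j\<in>{1..n}. if j = b then (if i = a then F i j else 0) else 0)"
    by (intro sum.cong refl) auto
  with assms show ?thesis
    by simp
qed

lemma kernel_sum_apply:
  "\<sigma> \<in> Sn n \<Longrightarrow> kernel_sum n \<kappa> c \<sigma> = (\<Sum>i\<in>{1..n}. \<Sum>j\<in>{1..n}. c i j * \<kappa> (\<sigma> i) (\<sigma> j))"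
  by (simp add: kernel_sum_def)

lemma kernel_sum_in_galg [simp]: "kernel_sum n \<kappa> c \<in> galg n"
  by (simp add: kernel_sum_def)

lemma kernel_gen_in_galg [simp]: "kernel_gen n \<kappa> a b \<in> galg n"
  by (simp add: kernel_gen_def)

lemma kernel_sum_add:
  "kernel_sum n \<kappa> c + kernel_sum n \<kappa> d = kernel_sum n \<kappa> (\<lambda>i j. c i j + d i j)"
  by (simp add: kernel_sum_def galg_of_add sum.distrib algebra_simps)

lemma kernel_sum_diff:
  "kernel_sum n \<kappa> c - kernel_sum n \<kappa> d = kernel_sum n \<kappa> (\<lambda>i j. c i j - d i j)"
  by (simp add: kernel_sum_def galg_of_diff sum_subtractf algebra_simps)

lemma kernel_sum_scale:
  "fscale k (kernel_sum n \<kappa> c) = kernel_sum n \<kappa> (\<lambda>i j. k * c i j)"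
  by (simp add: kernel_sum_def galg_of_scale sum_distrib_left algebra_simps)

lemma kernel_sum_zero: "kernel_sum n \<kappa> (\<lambda>i j. 0) = 0"
  by (simp add: kernel_sum_def galg_of_zero)

text \<open>Reindexing both sums by \<open>g\<close> moves the group element from the argument
  \<open>\<sigma>\<close> to the coefficients. This makes the range invariant for every
  kernel.\<close>

lemma kernel_sum_act:
  assumes "g \<in> Sn n"
  shows "rep_act (left_regular n) g (kernel_sum n \<kappa> c) = kernel_sum n \<kappa> (\<lambda>i j. c (g i) (g j))"
proof -
  have "kernel_sum n \<kappa> c (\<sigma> \<circ> inv g)
      = (\<Sum>i\<in>{1..n}. \<Sum>j\<in>{1..n}. c (g i) (g j) * \<kappa> (\<sigma> i) (\<sigma> j))" if "\<sigma> \<in> Sn n" for \<sigma>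
  proof -
    have "kernel_sum n \<kappa> c (\<sigma> \<circ> inv g)
        = (\<Sum>i\<in>{1..n}. \<Sum>j\<in>{1..n}. c i j * \<kappa> (\<sigma> (inv g i)) (\<sigma> (inv g j)))"
      using assms that by (simp add: kernel_sum_apply)
    also have "\<dots> = (\<Sum>i\<in>{1..n}. \<Sum>j\<in>{1..n}. c (g i) j * \<kappa> (\<sigma> i) (\<sigma> (inv g j)))"
      by (subst sum_Sn_reindex [OF assms, of "\<lambda>i. \<Sum>j\<in>{1..n}. c i j * \<kappa> (\<sigma> (inv g i)) (\<sigma> (inv g j))",
            symmetric]) (simp add: Sn_inv_apply [OF assms])
    also have "\<dots> = (\<Sum>i\<in>{1..n}. \<Sum>j\<in>{1..n}. c (g i) (g j) * \<kappa> (\<sigma> i) (\<sigma> j))"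
      by (rule sum.cong [OF refl], subst sum_Sn_reindex [OF assms, symmetric]) (simp add: Sn_inv_apply [OF assms])
    finally show ?thesis .
  qed
  with assms show ?thesis
    by (simp add: left_regular_act kernel_sum_def [of n \<kappa> "\<lambda>i j. c (g i) (g j)"] galg_of_eq_iff)
qed

lemma kernel_gen_eq_sum:
  assumes "a \<in> {1..n}" "b \<in> {1..n}"
  shows "kernel_gen n \<kappa> a b = kernel_sum n \<kappa> (\<lambda>i j. of_bool (i = a \<and> j = b))"
  unfolding kernel_gen_def kernel_sum_def galg_of_eq_iff
  by (intro ballI, subst mult.commute, subst sum_sum_delta [OF assms]) (rule refl)

lemma kernel_sum_expand:
  "kernel_sum n \<kappa> c = (\<Sum>i\<in>{1..n}. \<Sum>j\<in>{1..n}. fscale (c i j) (kernel_gen n \<kappa> i j))"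
  by (simp add: kernel_sum_def kernel_gen_def galg_of_scale galg_of_sum)

lemma invariant_range_kernel_sum:
  "invariant_subspace n (left_regular n) (range (kernel_sum n \<kappa>))"
  unfolding invariant_subspace_def
  using rangeI [of "kernel_sum n \<kappa>" "\<lambda>i j. 0"]
  by (auto simp: kernel_sum_add kernel_sum_scale kernel_sum_act kernel_sum_zero)

lemma invariant_subspace_imp_subspace:
  "invariant_subspace n (left_regular n) U \<Longrightarrow> fvs.subspace U"
  by (simp add: invariant_subspace_def fvs.subspace_def)

text \<open>The range is spanned by the generators \<open>kernel_gen\<close>, so later inclusions
  are checked on these only.\<close>

lemma range_kernel_sum_subset:
  assumes "fvs.subspace U" "\<And>a b. a \<in> {1..n} \<Longrightarrow> b \<in> {1..n} \<Longrightarrow> kernel_gen n \<kappa> a b \<in> U"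
  shows "range (kernel_sum n \<kappa>) \<subseteq> U"
  using assms
  by (auto simp: kernel_sum_expand intro!: fvs.subspace_sum fvs.subspace_scale)

lemma subspace_range_kernel_sum: "fvs.subspace (range (kernel_sum n \<kappa>))"
  by (rule invariant_subspace_imp_subspace [OF invariant_range_kernel_sum])

lemma kernel_gen_in_range:
  "a \<in> {1..n} \<Longrightarrow> b \<in> {1..n} \<Longrightarrow> kernel_gen n \<kappa> a b \<in> range (kernel_sum n \<kappa>)"
  by (simp add: kernel_gen_eq_sum)

lemma kernel_sum_swap:
  assumes "\<And>x y. \<kappa> x y = - \<kappa> y x"
  shows "kernel_sum n \<kappa> (\<lambda>i j. c j i) = kernel_sum n \<kappa> (\<lambda>i j. - c i j)"
proof -
  have "(\<Sum>i\<in>{1..n}. \<Sum>j\<in>{1..n}. c j i * \<kappa> (\<sigma> i) (\<sigma> j))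
      = (\<Sum>i\<in>{1..n}. \<Sum>j\<in>{1..n}. - c i j * \<kappa> (\<sigma> i) (\<sigma> j))" for \<sigma>
    by (subst sum.swap, intro sum.cong refl) (metis assms mult_minus_left mult_minus_right)
  then show ?thesis
    by (simp add: kernel_sum_def)
qed

text \<open>Transposing \<open>c\<close> negates the sum for an antisymmetric kernel, so for
  symmetric \<open>c\<close> the sum is its own negative.\<close>

lemma kernel_sum_symmetric:
  assumes "\<And>x y. \<kappa> x y = - \<kappa> y x" and "\<And>i j. i \<in> {1..n} \<Longrightarrow> j \<in> {1..n} \<Longrightarrow> c i j = c j i"
  shows "kernel_sum n \<kappa> c = 0"
proof -
  have "kernel_sum n \<kappa> c = kernel_sum n \<kappa> (\<lambda>i j. c j i)"
    unfolding kernel_sum_def galg_of_eq_iff using assms(2) by (intro ballI sum.cong refl) auto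
  also have "\<dots> = kernel_sum n \<kappa> (\<lambda>i j. - c i j)"
    using assms(1) by (rule kernel_sum_swap)
  also have "\<dots> = - kernel_sum n \<kappa> c"
    using kernel_sum_diff [of n \<kappa> "\<lambda>i j. 0" c] by (simp add: kernel_sum_zero)
  finally have "kernel_sum n \<kappa> c \<sigma> = - kernel_sum n \<kappa> c \<sigma>" for \<sigma>
    by (metis fun_Compl_def)
  then show ?thesis
    by (auto simp: fun_eq_iff)
qed

section \<open>The inversion kernel and the space \<open>H_space\<close>\<close>

definition inv_kernel :: "nat \<Rightarrow> nat \<Rightarrow> complex" where
  "inv_kernel x y = (if x < y then 1 else if y < x then - 1 else 0)"

lemma inv_kernel_antisym: "inv_kernel x y = - inv_kernel y x"
  by (simp add: inv_kernel_def)

text \<open>Distinct positions carry distinct values, so the diagonal value 0 of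
  \<open>inv_kernel\<close>, which antisymmetry forces, never meets the default -1 of
  \<open>e_vec\<close>.\<close>

lemma e_vec_eq:
  assumes "i < j"
  shows "e_vec n i j = fscale (complex_of_real (1 / sqrt (fact n))) (kernel_gen n inv_kernel i j)"
proof -
  have "galg_of n (\<lambda>\<sigma>. if \<sigma> i < \<sigma> j then 1 else - 1) = kernel_gen n inv_kernel i j"
    using assms by (auto simp: kernel_gen_def galg_of_eq_iff inv_kernel_def Sn_inj not_less le_less)
  then show ?thesis
    by (simp add: e_vec_def)
qed

text \<open>The vectors \<open>e_vec\<close> cover only pairs \<open>i < j\<close>. Reversed pairs
  add negatives, diagonal pairs add zero, and scaling by \<open>sqrt (fact n)\<close> undoes the
  normalization.\<close>

lemma H_space_eq_range: "H_space n = range (kernel_sum n inv_kernel)"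
proof
  show "H_space n \<subseteq> range (kernel_sum n inv_kernel)"
    unfolding H_space_def
    by (rule fvs.span_minimal [OF _ subspace_range_kernel_sum])
      (auto simp: e_vec_eq intro!: fvs.subspace_scale [OF subspace_range_kernel_sum] kernel_gen_in_range)
  have upper: "kernel_gen n inv_kernel a b \<in> H_space n"
    if "a \<in> {1..n}" "b \<in> {1..n}" "a < b" for a b
  proof -
    have "e_vec n a b \<in> H_space n"
      using that unfolding H_space_def by (intro fvs.span_base) auto
    then have "fscale (complex_of_real (sqrt (fact n))) (e_vec n a b) \<in> H_space n"
      unfolding H_space_def by (rule fvs.span_scale)
    then show ?thesis
      using that(3) by (simp add: e_vec_eq fvs.scale_one flip: of_real_mult)
  qed
  show "range (kernel_sum n inv_kernel) \<subseteq> H_space n"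
  proof (rule range_kernel_sum_subset)
    show "fvs.subspace (H_space n)"
      by (simp add: H_space_def)
    fix a b
    assume ab: "a \<in> {1..n}" "b \<in> {1..n}"
    have swap: "kernel_gen n inv_kernel a b = fscale (- 1) (kernel_gen n inv_kernel b a)"
      by (simp add: kernel_gen_def galg_of_scale galg_of_eq_iff) (metis inv_kernel_antisym)
    consider "a = b" | "a < b" | "b < a"
      by linarith
    then show "kernel_gen n inv_kernel a b \<in> H_space n"
    proof cases
      case 1
      then have "kernel_gen n inv_kernel a b = 0"
        by (simp add: kernel_gen_def inv_kernel_def galg_of_zero)
      then show ?thesis
        by (simp add: H_space_def fvs.span_zero)
    next
      case 2
      with upper ab show ?thesis
        by blast
    next
      case 3
      then show ?thesis
        unfolding swap using upper [OF ab(2,1)] unfolding H_space_def by (intro fvs.span_scale)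
    qed
  qed
qed

text \<open>This amounts to linear independence of the inversion functions. Put the values 1 and 2
  at positions \<open>a\<close> and \<open>b\<close>, then exchange them: no value lies between 1
  and 2, so only the comparison of \<open>a\<close> with \<open>b\<close> changes, and the two
  function values differ by \<open>2 * c a b - 2 * c b a\<close>.\<close>

lemma kernel_sum_inv_eq_0_iff:
  assumes "n \<ge> 3"
  shows "kernel_sum n inv_kernel c = 0 \<longleftrightarrow> (\<forall>i\<in>{1..n}. \<forall>j\<in>{1..n}. c i j = c j i)"
proof
  assume 0: "kernel_sum n inv_kernel c = 0"
  have "c a b = c b a" if ab: "a \<in> {1..n}" "b \<in> {1..n}" "a \<noteq> b" for a b
  proof -
    obtain \<sigma> where \<sigma>: "\<sigma> \<in> Sn n" "\<sigma> a = 1" "\<sigma> b = 2"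
      using Sn_with_two_values [of n a b 1 2] assms ab by auto
    define \<tau> where "\<tau> = transpose 1 2 \<circ> \<sigma>"
    have \<tau>: "\<tau> \<in> Sn n"
      using assms \<sigma> by (simp add: \<tau>_def)
    have jump: "inv_kernel (\<sigma> i) (\<sigma> j) - inv_kernel (\<tau> i) (\<tau> j)
        = 2 * of_bool (i = a \<and> j = b) - 2 * of_bool (i = b \<and> j = a)"
      if ij: "i \<in> {1..n}" "j \<in> {1..n}" for i j
    proof -
      have "i = a \<longleftrightarrow> \<sigma> i = 1" "j = a \<longleftrightarrow> \<sigma> j = 1" "i = b \<longleftrightarrow> \<sigma> i = 2" "j = b \<longleftrightarrow> \<sigma> j = 2"
        using \<sigma> Sn_inj by metis+
      moreover have "\<sigma> i \<ge> 1" "\<sigma> j \<ge> 1"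
        using Sn_apply_in [OF \<sigma>(1)] ij by (meson atLeastAtMost_iff)+
      ultimately show ?thesis
        by (auto simp: \<tau>_def transpose_def inv_kernel_def)
    qed
    have "0 = kernel_sum n inv_kernel c \<sigma> - kernel_sum n inv_kernel c \<tau>"
      by (simp add: 0)
    also have "\<dots> = (\<Sum>i\<in>{1..n}. \<Sum>j\<in>{1..n}.
        c i j * (inv_kernel (\<sigma> i) (\<sigma> j) - inv_kernel (\<tau> i) (\<tau> j)))"
      by (simp add: kernel_sum_apply \<sigma> \<tau> sum_subtractf right_diff_distrib)
    also have "\<dots> = (\<Sum>i\<in>{1..n}. \<Sum>j\<in>{1..n}.
        c i j * (2 * of_bool (i = a \<and> j = b) - 2 * of_bool (i = b \<and> j = a)))"
      by (intro sum.cong refl) (simp add: jump)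
    also have "\<dots> = 2 * (\<Sum>i\<in>{1..n}. \<Sum>j\<in>{1..n}. c i j * of_bool (i = a \<and> j = b))
        - 2 * (\<Sum>i\<in>{1..n}. \<Sum>j\<in>{1..n}. c i j * of_bool (i = b \<and> j = a))"
      by (simp add: sum_subtractf right_diff_distrib sum_distrib_left mult.left_commute
          del: sum_mult_of_bool_eq)
    also have "\<dots> = 2 * c a b - 2 * c b a"
      unfolding sum_sum_delta [OF ab(1,2)] sum_sum_delta [OF ab(2,1)] ..
    finally show ?thesis
      by simp
  qed
  then show "\<forall>i\<in>{1..n}. \<forall>j\<in>{1..n}. c i j = c j i"
    by metis
next
  assume "\<forall>i\<in>{1..n}. \<forall>j\<in>{1..n}. c i j = c j i"
  then show "kernel_sum n inv_kernel c = 0"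
    by (intro kernel_sum_symmetric inv_kernel_antisym) auto
qed

section \<open>Right multiplication by a weighted descent statistic\<close>

text \<open>Treats \<open>des\<close> and \<open>maj\<close> together; only the total weight will
  enter the eigenvalues.\<close>

definition desc_stat :: "nat \<Rightarrow> (nat \<Rightarrow> nat) \<Rightarrow> (nat \<Rightarrow> nat) \<Rightarrow> nat" where
  "desc_stat n w \<sigma> = (\<Sum>i\<in>Des n \<sigma>. w i)"

lemma des_eq_desc_stat: "des n = desc_stat n (\<lambda>i. 1)"
  by (simp add: fun_eq_iff des_def desc_stat_def)

lemma maj_eq_desc_stat: "maj n = desc_stat n (\<lambda>i. i)"
  by (simp add: fun_eq_iff maj_def desc_stat_def)

abbreviation (input) one_vec :: "nat \<Rightarrow> (nat \<Rightarrow> nat) \<Rightarrow> complex" where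
  "one_vec n \<equiv> galg_of n (\<lambda>\<sigma>. 1)"

lemma one_vec_nonzero: "one_vec n \<noteq> 0"
proof -
  have "one_vec n id \<noteq> 0"
    by simp
  then show ?thesis
    by (metis zero_fun_apply)
qed

lemma of_nat_desc_stat:
  assumes "\<sigma> \<in> Sn n"
  shows "(of_nat (desc_stat n w \<sigma>) :: complex)
    = (\<Sum>i\<in>{1..n - 1}. of_nat (w i) * (1 - inv_kernel (\<sigma> i) (\<sigma> (i + 1))) / 2)"
proof -
  have "(of_nat (desc_stat n w \<sigma>) :: complex)
      = (\<Sum>i\<in>{1..n - 1}. if \<sigma> i > \<sigma> (i + 1) then of_nat (w i) else 0)"
    unfolding desc_stat_def Des_def of_nat_sum by (rule sum.inter_filter) simp
  also have "\<dots> = (\<Sum>i\<in>{1..n - 1}. of_nat (w i) * (1 - inv_kernel (\<sigma> i) (\<sigma> (i + 1))) / 2)"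
  proof (rule sum.cong [OF refl])
    fix i
    have "\<sigma> i \<noteq> \<sigma> (i + 1)"
      using Sn_inj [OF assms] by simp
    then show "(if \<sigma> i > \<sigma> (i + 1) then of_nat (w i) else 0)
        = of_nat (w i) * (1 - inv_kernel (\<sigma> i) (\<sigma> (i + 1))) / 2"
      by (auto simp: inv_kernel_def)
  qed
  finally show ?thesis .
qed

section \<open>The operator on the constants, on the generators and on the whole algebra\<close>

lemma M_op_eq:
  "M_op n \<epsilon> f = galg_of n (\<lambda>\<sigma>. \<Sum>g\<in>Sn n. f g * of_nat (\<epsilon> (\<sigma> \<circ> inv g)))"
  unfolding M_op_def galg_mult_def galg_of_eq_iff
  by (intro ballI sum.cong) (simp_all add: perm_mult_comp)

lemma M_op_add: "M_op n \<epsilon> (f + h) = M_op n \<epsilon> f + M_op n \<epsilon> h"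
  by (simp add: M_op_eq galg_of_add sum.distrib distrib_right)

lemma M_op_scale: "M_op n \<epsilon> (fscale c f) = fscale c (M_op n \<epsilon> f)"
  unfolding M_op_eq galg_of_scale by (simp add: fscale_def sum_distrib_left mult.assoc)

lemma M_op_zero: "M_op n \<epsilon> 0 = 0"
  by (simp add: M_op_eq galg_of_zero)

lemma subspace_eigenspace: "fvs.subspace (eigenspace n (M_op n \<epsilon>) s)"
  unfolding fvs.subspace_def eigenspace_def
  using fvs.subspace_0 [OF subspace_galg] fvs.subspace_add [OF subspace_galg]
    fvs.subspace_scale [OF subspace_galg]
  by (auto simp: M_op_add M_op_scale M_op_zero fvs.scale_right_distrib mult.commute)

text \<open>In \<open>(1 - inv_kernel) / 2\<close> the 1 yields a constant function, while the
  inversion term, as a function of \<open>\<sigma>\<close>, is the generator at the positions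
  \<open>inv g i\<close> and \<open>inv g (i + 1)\<close>.\<close>

lemma M_op_desc_stat:
  fixes n w
  defines "K \<equiv> \<Sum>i\<in>{1..n - 1}. w i"
  shows "M_op n (desc_stat n w) f = galg_of n (\<lambda>\<sigma>. of_nat K / 2 * (\<Sum>g\<in>Sn n. f g)
     - (\<Sum>i\<in>{1..n - 1}. of_nat (w i) / 2 *
          (\<Sum>g\<in>Sn n. f g * inv_kernel (\<sigma> (inv g i)) (\<sigma> (inv g (i + 1))))))"
  unfolding M_op_eq galg_of_eq_iff
proof
  fix \<sigma>
  assume \<sigma>: "\<sigma> \<in> Sn n"
  have "(\<Sum>g\<in>Sn n. f g * of_nat (desc_stat n w (\<sigma> \<circ> inv g)))
      = (\<Sum>g\<in>Sn n. (\<Sum>i\<in>{1..n - 1}. of_nat (w i) / 2 * f g)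
          - (\<Sum>i\<in>{1..n - 1}. of_nat (w i) / 2 * (f g * inv_kernel (\<sigma> (inv g i)) (\<sigma> (inv g (i + 1))))))"
    using \<sigma>
    by (intro sum.cong refl)
      (simp add: of_nat_desc_stat sum_distrib_left field_simps flip: sum_subtractf)
  also have "\<dots> = (\<Sum>g\<in>Sn n. \<Sum>i\<in>{1..n - 1}. of_nat (w i) / 2 * f g)
      - (\<Sum>g\<in>Sn n. \<Sum>i\<in>{1..n - 1}. of_nat (w i) / 2 * (f g * inv_kernel (\<sigma> (inv g i)) (\<sigma> (inv g (i + 1)))))"
    by (simp add: sum_subtractf)
  also have "(\<Sum>g\<in>Sn n. \<Sum>i\<in>{1..n - 1}. of_nat (w i) / 2 * f g) = of_nat K / 2 * (\<Sum>g\<in>Sn n. f g)"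
    by (subst sum.swap) (simp add: K_def sum_product sum_divide_distrib)
  also have "(\<Sum>g\<in>Sn n. \<Sum>i\<in>{1..n - 1}. of_nat (w i) / 2 * (f g * inv_kernel (\<sigma> (inv g i)) (\<sigma> (inv g (i + 1)))))
      = (\<Sum>i\<in>{1..n - 1}. of_nat (w i) / 2 *
          (\<Sum>g\<in>Sn n. f g * inv_kernel (\<sigma> (inv g i)) (\<sigma> (inv g (i + 1)))))"
    by (subst sum.swap) (simp add: sum_distrib_left)
  finally show "(\<Sum>g\<in>Sn n. f g * of_nat (desc_stat n w (\<sigma> \<circ> inv g)))
      = of_nat K / 2 * (\<Sum>g\<in>Sn n. f g)
     - (\<Sum>i\<in>{1..n - 1}. of_nat (w i) / 2 *
          (\<Sum>g\<in>Sn n. f g * inv_kernel (\<sigma> (inv g i)) (\<sigma> (inv g (i + 1)))))" .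
qed

text \<open>Exchanging the positions \<open>a\<close> and \<open>b\<close> negates the sum. In other
  words, the generators are orthogonal to the constants.\<close>

lemma sum_inv_kernel_eq_0:
  assumes "a \<in> {1..n}" "b \<in> {1..n}"
  shows "(\<Sum>g\<in>Sn n. inv_kernel (g a) (g b)) = 0"
proof -
  have "(\<Sum>g\<in>Sn n. inv_kernel (g a) (g b)) = (\<Sum>g\<in>Sn n. inv_kernel (g b) (g a))"
    using sum_Sn_comp_right [OF transpose_in_Sn [OF assms], of "\<lambda>g. inv_kernel (g a) (g b)"] by simp
  also have "\<dots> = - (\<Sum>g\<in>Sn n. inv_kernel (g a) (g b))"
    unfolding sum_negf [symmetric] by (intro sum.cong refl inv_kernel_antisym)
  finally show ?thesis
    by simp
qed

text \<open>
  Replacing \<open>g\<close> by \<open>transpose i (i + 1) \<circ> g\<close> flips the second factor, and leaves the first one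
  unchanged unless \<open>{g a, g b} = {i, i + 1}\<close>; all other terms cancel in pairs.
\<close>

lemma sum_inv_kernel_mult:
  assumes n: "n \<ge> 3" and ab: "a \<in> {1..n}" "b \<in> {1..n}" "a \<noteq> b"
    and i: "i \<in> {1..n - 1}" and \<sigma>: "\<sigma> \<in> Sn n"
  shows "(\<Sum>g\<in>Sn n. inv_kernel (g a) (g b) * inv_kernel (\<sigma> (inv g i)) (\<sigma> (inv g (i + 1))))
    = 2 * fact (n - 2) * inv_kernel (\<sigma> a) (\<sigma> b)"
proof -
  define t where "t = transpose i (i + 1)"
  define q where "q g = inv_kernel (\<sigma> (inv g i)) (\<sigma> (inv g (i + 1)))" for g
  define X where "X = (\<Sum>g\<in>Sn n. inv_kernel (g a) (g b) * q g)"
  have i': "i \<in> {1..n}" "i + 1 \<in> {1..n}"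
    using i n by auto
  then have t: "t \<in> Sn n"
    unfolding t_def by (rule transpose_in_Sn)
  have q: "q (t \<circ> g) = - q g" if "g \<in> Sn n" for g
    using Sn_inv_comp [OF t that] by (simp add: q_def t_def) (metis inv_kernel_antisym)
  have jump: "inv_kernel x y - inv_kernel (t x) (t y)
      = 2 * of_bool (x = i \<and> y = i + 1) - 2 * of_bool (x = i + 1 \<and> y = i)" for x y
    by (auto simp: t_def transpose_def inv_kernel_def)
  have "X = (\<Sum>g\<in>Sn n. inv_kernel ((t \<circ> g) a) ((t \<circ> g) b) * q (t \<circ> g))"
    unfolding X_def by (rule sum_Sn_comp_left [OF t, symmetric])
  also have "\<dots> = - (\<Sum>g\<in>Sn n. inv_kernel (t (g a)) (t (g b)) * q g)"
    unfolding sum_negf [symmetric] by (intro sum.cong refl) (simp add: q)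
  finally have "2 * X = (\<Sum>g\<in>Sn n. (inv_kernel (g a) (g b) - inv_kernel (t (g a)) (t (g b))) * q g)"
    by (simp add: X_def left_diff_distrib sum_subtractf)
  also have "\<dots> = (\<Sum>g\<in>Sn n. 2 * inv_kernel (\<sigma> a) (\<sigma> b) *
      (of_bool (g a = i \<and> g b = i + 1) + of_bool (g a = i + 1 \<and> g b = i)))"
  proof (rule sum.cong [OF refl])
    fix g
    assume g: "g \<in> Sn n"
    have "inv g (g a) = a" "inv g (g b) = b"
      by (simp_all add: Sn_inv_apply [OF g])
    then have "q g = inv_kernel (\<sigma> a) (\<sigma> b)" if "g a = i" "g b = i + 1"
      using that unfolding q_def by metis
    moreover have "q g = - inv_kernel (\<sigma> a) (\<sigma> b)" if "g a = i + 1" "g b = i"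
      using that \<open>inv g (g a) = a\<close> \<open>inv g (g b) = b\<close> inv_kernel_antisym [of "\<sigma> b" "\<sigma> a"]
      unfolding q_def by metis
    ultimately show "(inv_kernel (g a) (g b) - inv_kernel (t (g a)) (t (g b))) * q g
        = 2 * inv_kernel (\<sigma> a) (\<sigma> b) *
          (of_bool (g a = i \<and> g b = i + 1) + of_bool (g a = i + 1 \<and> g b = i))"
      unfolding jump by auto
  qed
  also have "\<dots> = 2 * inv_kernel (\<sigma> a) (\<sigma> b) *
      (of_nat (card {g \<in> Sn n. g a = i \<and> g b = i + 1}) + of_nat (card {g \<in> Sn n. g a = i + 1 \<and> g b = i}))"
    by (simp add: sum.distrib Int_def flip: sum_distrib_left del: sum_mult_of_bool_eq)
  \<comment> \<open>Each of the two conditions on \<open>g\<close> holds for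
    \<open>fact (n - 2)\<close> permutations.\<close>
  also have "\<dots> = 4 * fact (n - 2) * inv_kernel (\<sigma> a) (\<sigma> b)"
    using card_Sn_two_values [OF n ab(1,2) i' ab(3)] card_Sn_two_values [OF n ab(1,2) i'(2,1) ab(3)]
    by simp
  finally show ?thesis
    by (simp add: X_def q_def)
qed

text \<open>For a constant function the inversion terms become full sums over the group, after
  inverting and translating \<open>g\<close>, and vanish. What remains is half the total weight
  times \<open>fact n\<close>.\<close>

lemma M_op_one_vec:
  fixes w n
  defines "K \<equiv> \<Sum>i\<in>{1..n - 1}. w i"
  shows "M_op n (desc_stat n w) (one_vec n) = fscale (fact n * of_nat K / 2) (one_vec n)"
proof -
  have "(\<Sum>g\<in>Sn n. one_vec n g * inv_kernel (\<sigma> (inv g i)) (\<sigma> (inv g (i + 1)))) = 0"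
    if "i \<in> {1..n - 1}" "\<sigma> \<in> Sn n" for i \<sigma>
  proof -
    have i: "i \<in> {1..n}" "i + 1 \<in> {1..n}"
      using that(1) by auto
    have "(\<Sum>g\<in>Sn n. one_vec n g * inv_kernel (\<sigma> (inv g i)) (\<sigma> (inv g (i + 1))))
        = (\<Sum>g\<in>Sn n. inv_kernel ((\<sigma> \<circ> inv g) i) ((\<sigma> \<circ> inv g) (i + 1)))"
      by (intro sum.cong) simp_all
    also have "\<dots> = (\<Sum>g\<in>Sn n. inv_kernel ((\<sigma> \<circ> g) i) ((\<sigma> \<circ> g) (i + 1)))"
      by (rule sum_Sn_inv)
    also have "\<dots> = (\<Sum>g\<in>Sn n. inv_kernel (g i) (g (i + 1)))"
      by (rule sum_Sn_comp_left [OF that(2)])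
    also have "\<dots> = 0"
      by (rule sum_inv_kernel_eq_0 [OF i])
    finally show ?thesis .
  qed
  then show ?thesis
    by (simp add: M_op_desc_stat K_def galg_of_scale galg_of_eq_iff)
qed

text \<open>The constant part vanishes because a generator sums to zero. Each \<open>i\<close> then
  contributes \<open>w i / 2\<close> times \<open>2 * fact (n - 2)\<close>, with the minus sign of
  the descent formula.\<close>

lemma M_op_kernel_gen:
  fixes w n
  defines "K \<equiv> \<Sum>i\<in>{1..n - 1}. w i"
  assumes "n \<ge> 3" "a \<in> {1..n}" "b \<in> {1..n}"
  shows "M_op n (desc_stat n w) (kernel_gen n inv_kernel a b)
    = fscale (- (fact (n - 2) * of_nat K)) (kernel_gen n inv_kernel a b)"
proof (cases "a = b")
  case True
  then have "kernel_gen n inv_kernel a b = 0"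
    by (simp add: kernel_gen_def inv_kernel_def galg_of_zero)
  then show ?thesis
    by (simp add: M_op_zero)
next
  case False
  have sum0: "(\<Sum>g\<in>Sn n. kernel_gen n inv_kernel a b g) = 0"
    using sum_inv_kernel_eq_0 [OF assms(3,4)] by (simp add: kernel_gen_def)
  have "(\<Sum>g\<in>Sn n. kernel_gen n inv_kernel a b g * inv_kernel (\<sigma> (inv g i)) (\<sigma> (inv g (i + 1))))
      = 2 * fact (n - 2) * inv_kernel (\<sigma> a) (\<sigma> b)" if "i \<in> {1..n - 1}" "\<sigma> \<in> Sn n" for i \<sigma>
    using sum_inv_kernel_mult [OF assms(2-4) False that] by (simp add: kernel_gen_def)
  then have "M_op n (desc_stat n w) (kernel_gen n inv_kernel a b)
      = galg_of n (\<lambda>\<sigma>. - (\<Sum>i\<in>{1..n - 1}. of_nat (w i) / 2 * (2 * fact (n - 2) * inv_kernel (\<sigma> a) (\<sigma> b))))"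
    unfolding M_op_desc_stat sum0 galg_of_eq_iff by (simp add: sum0)
  also have "\<dots> = fscale (- (fact (n - 2) * of_nat K)) (kernel_gen n inv_kernel a b)"
    by (simp add: kernel_gen_def galg_of_scale galg_of_eq_iff K_def sum_distrib_left sum_distrib_right
        ac_simps)
  finally show ?thesis .
qed

text \<open>This bounds the image: every eigenvector with nonzero eigenvalue must lie in the sum of
  the constants and \<open>H_space n\<close>.\<close>

lemma M_op_image:
  "\<exists>c. \<exists>h\<in>H_space n. M_op n (desc_stat n w) f = fscale c (one_vec n) + h"
proof -
  define c where "c = of_nat (\<Sum>i\<in>{1..n - 1}. w i) / 2 * (\<Sum>g\<in>Sn n. f g)"
  define h where "h = (\<Sum>i\<in>{1..n - 1}. \<Sum>g\<in>Sn n.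
    fscale (- (of_nat (w i) / 2 * f g)) (kernel_gen n inv_kernel (inv g i) (inv g (i + 1))))"
  have sub: "fvs.subspace (H_space n)"
    by (simp add: H_space_def)
  have "kernel_gen n inv_kernel (inv g i) (inv g (i + 1)) \<in> H_space n"
    if "i \<in> {1..n - 1}" "g \<in> Sn n" for i g
  proof -
    have "i \<in> {1..n}" "i + 1 \<in> {1..n}"
      using that(1) by auto
    then show ?thesis
      unfolding H_space_eq_range by (intro kernel_gen_in_range) (simp_all add: that Sn_apply_in del: atLeastAtMost_iff)
  qed
  then have "h \<in> H_space n"
    unfolding h_def by (intro fvs.subspace_sum [OF sub] fvs.subspace_scale [OF sub])
  moreover have "M_op n (desc_stat n w) f = fscale c (one_vec n) + h"
    unfolding M_op_desc_stat h_def kernel_gen_def galg_of_scale galg_of_sum galg_of_add c_def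
    by (simp add: sum_negf sum_distrib_left mult.assoc)
  ultimately show ?thesis
    by blast
qed

text \<open>Summation over the group separates the two parts of the image: it kills
  \<open>H_space n\<close> but no nonzero constant.\<close>

lemma sum_H_space_eq_0:
  assumes "h \<in> H_space n"
  shows "(\<Sum>\<sigma>\<in>Sn n. h \<sigma>) = 0"
proof -
  have "fvs.subspace {h. (\<Sum>\<sigma>\<in>Sn n. h \<sigma>) = 0}"
    by (auto simp: fvs.subspace_def fscale_def sum.distrib simp flip: sum_distrib_left)
  then have "range (kernel_sum n inv_kernel) \<subseteq> {h. (\<Sum>\<sigma>\<in>Sn n. h \<sigma>) = 0}"
    by (rule range_kernel_sum_subset) (simp add: kernel_gen_def sum_inv_kernel_eq_0 del: atLeastAtMost_iff)
  with assms show ?thesis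
    by (auto simp: H_space_eq_range)
qed

lemma H_space_nonzero:
  assumes "n \<ge> 3"
  shows "\<exists>h\<in>H_space n. h \<noteq> 0"
proof
  have "kernel_gen n inv_kernel 1 2 id \<noteq> 0"
    by (simp add: kernel_gen_def inv_kernel_def)
  then show "kernel_gen n inv_kernel 1 2 \<noteq> 0"
    by (metis zero_fun_apply)
  show "kernel_gen n inv_kernel 1 2 \<in> H_space n"
    using assms by (simp add: H_space_eq_range kernel_gen_in_range)
qed

text \<open>For \<open>s \<noteq> 0\<close> an eigenvector is its own image divided by
  \<open>s\<close>, hence a constant plus an element of \<open>H_space n\<close>. The operator
  scales these parts by \<open>s0\<close> and \<open>s1\<close>, so a part can be nonzero only if
  \<open>s\<close> is the corresponding eigenvalue.\<close>

lemma eigenspaces_desc_stat: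
  fixes w n
  defines "K \<equiv> \<Sum>i\<in>{1..n - 1}. w i"
  assumes n: "n \<ge> 3" and K: "K > 0"
  defines "M \<equiv> M_op n (desc_stat n w)"
    and "s0 \<equiv> fact n * of_nat K / 2" and "s1 \<equiv> - (fact (n - 2) * of_nat K)"
  shows "{s. is_eigenvalue n M s \<and> s \<noteq> 0} = {s0, s1}"
    and "eigenspace n M s0 = fvs.span {one_vec n}"
    and "eigenspace n M s1 = H_space n"
proof -
  have sub: "fvs.subspace (H_space n)"
    by (simp add: H_space_def)
  have one: "one_vec n \<in> eigenspace n M s0"
    unfolding eigenspace_def M_def s0_def K_def by (simp add: M_op_one_vec)
  have H: "H_space n \<subseteq> eigenspace n M s1"
    unfolding H_space_eq_range M_def
    by (rule range_kernel_sum_subset [OF subspace_eigenspace])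
      (simp add: eigenspace_def M_op_kernel_gen n s1_def K_def del: atLeastAtMost_iff)
  \<comment> \<open>The signs are read off over the reals; they separate \<open>s0\<close> and
    \<open>s1\<close> from each other and from 0.\<close>
  have s0_pos: "s0 = complex_of_real (fact n * real K / 2)" "fact n * real K / 2 > 0"
    and s1_neg: "s1 = complex_of_real (- (fact (n - 2) * real K))" "fact (n - 2) * real K > 0"
    using K by (simp_all add: s0_def s1_def)
  then have "fact n * real K / 2 \<noteq> - (fact (n - 2) * real K)"
    by linarith
  then have s: "s0 \<noteq> 0" "s1 \<noteq> 0" "s0 \<noteq> s1"
    unfolding s0_pos s1_neg of_real_eq_iff of_real_eq_0_iff using s0_pos(2) s1_neg(2) by linarith+
  have decomp: "\<exists>c. \<exists>h\<in>H_space n. f = fscale c (one_vec n) + h \<and> (s \<noteq> s0 \<longrightarrow> c = 0) \<and> (s \<noteq> s1 \<longrightarrow> h = 0)"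
    if f: "f \<in> eigenspace n M s" and "s \<noteq> 0" for f s
  proof -
    obtain c h where h: "h \<in> H_space n" and Mf: "M f = fscale c (one_vec n) + h"
      using M_op_image unfolding M_def by metis
    define c' where "c' = c / s"
    define h' where "h' = fscale (1 / s) h"
    have h': "h' \<in> H_space n"
      unfolding h'_def by (rule fvs.subspace_scale [OF sub h])
    have fs: "M f = fscale s f"
      using f by (simp add: eigenspace_def)
    then have "f = fscale (1 / s) (M f)"
      using \<open>s \<noteq> 0\<close> by simp
    then have f': "f = fscale c' (one_vec n) + h'"
      unfolding Mf by (simp add: fvs.scale_right_distrib c'_def h'_def)
    have "M f = fscale c' (fscale s0 (one_vec n)) + fscale s1 h'"
      using one H h' unfolding f' M_def M_op_add M_op_scale by (auto simp: eigenspace_def)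
    then have step: "fscale s (fscale c' (one_vec n) + h') = fscale c' (fscale s0 (one_vec n)) + fscale s1 h'"
      using fs f' by simp
    have eq: "s * (c' * one_vec n \<sigma> + h' \<sigma>) = c' * (s0 * one_vec n \<sigma>) + s1 * h' \<sigma>" for \<sigma>
      using fun_cong [OF step, of \<sigma>] by (simp add: fscale_def)
    \<comment> \<open>Summing over the group removes \<open>h'\<close> and isolates the equation for
      the constant part; cancelling that from \<open>eq\<close> leaves the equation for
      \<open>h'\<close>.\<close>
    have "(\<Sum>\<sigma>\<in>Sn n. s * (c' * one_vec n \<sigma> + h' \<sigma>)) = s * (c' * fact n)"
      by (simp add: sum.distrib sum_H_space_eq_0 [OF h'] flip: sum_distrib_left)
    moreover have "(\<Sum>\<sigma>\<in>Sn n. c' * (s0 * one_vec n \<sigma>) + s1 * h' \<sigma>) = c' * (s0 * fact n)"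
      by (simp add: sum.distrib sum_H_space_eq_0 [OF h'] flip: sum_distrib_left)
    ultimately have "s * (c' * fact n) = c' * (s0 * fact n)"
      by (simp only: eq)
    then have c': "s * c' = s0 * c'"
      by (simp add: mult_ac)
    then have "s * h' \<sigma> = s1 * h' \<sigma>" for \<sigma>
      using eq [of \<sigma>] by (auto simp: algebra_simps)
    then have "s \<noteq> s1 \<longrightarrow> h' = 0"
      by (auto simp: fun_eq_iff)
    moreover have "s \<noteq> s0 \<longrightarrow> c' = 0"
      using c' by auto
    ultimately show ?thesis
      using f' h' by blast
  qed
  show E0: "eigenspace n M s0 = fvs.span {one_vec n}"
  proof
    show "eigenspace n M s0 \<subseteq> fvs.span {one_vec n}"
    proof
      fix f
      assume "f \<in> eigenspace n M s0"
      then obtain c where "f = fscale c (one_vec n)"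
        using decomp [OF _ s(1)] s(3) by (metis add.right_neutral)
      then show "f \<in> fvs.span {one_vec n}"
        by (simp add: fvs.span_scale fvs.span_base)
    qed
    show "fvs.span {one_vec n} \<subseteq> eigenspace n M s0"
      using one unfolding M_def by (intro fvs.span_minimal subspace_eigenspace) simp
  qed
  show E1: "eigenspace n M s1 = H_space n"
  proof (rule antisym [OF subsetI H])
    fix f
    assume "f \<in> eigenspace n M s1"
    then obtain h where "h \<in> H_space n" "f = fscale 0 (one_vec n) + h"
      using decomp [OF _ s(2)] s(3) by metis
    then show "f \<in> H_space n"
      by simp
  qed
  show "{s. is_eigenvalue n M s \<and> s \<noteq> 0} = {s0, s1}"
  proof
    show "{s. is_eigenvalue n M s \<and> s \<noteq> 0} \<subseteq> {s0, s1}"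
    proof
      fix s
      assume "s \<in> {s. is_eigenvalue n M s \<and> s \<noteq> 0}"
      then obtain f where "f \<in> eigenspace n M s" "f \<noteq> 0" "s \<noteq> 0"
        by (auto simp: is_eigenvalue_def)
      then have "s = s0 \<or> s = s1"
        using decomp [of f s] by auto
      then show "s \<in> {s0, s1}"
        by blast
    qed
    show "{s0, s1} \<subseteq> {s. is_eigenvalue n M s \<and> s \<noteq> 0}"
      unfolding is_eigenvalue_def using s one one_vec_nonzero H H_space_nonzero [OF n] by blast
  qed
qed

text \<open>The \<open>e_vec n i j\<close> with \<open>i < j\<close> form a basis: a vanishing
  combination has a strictly upper triangular coefficient array, which must be symmetric and is
  therefore zero.\<close>

lemma dim_H_space:
  assumes "n \<ge> 3"
  shows "fvs.dim (H_space n) = n * (n - 1) div 2"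
proof -
  \<comment> \<open>Pairs are stored with the larger index first, so the fibre over \<open>j\<close>
    is \<open>{1..<j}\<close> and the count is the sum of the \<open>j - 1\<close>.\<close>
  define P where "P = (SIGMA j:{1..n}. {1..<j})"
  define v where "v = (\<lambda>(j, i). e_vec n i j)"
  define r where "r = complex_of_real (1 / sqrt (fact n))"
  have [simp]: "finite P"
    by (simp add: P_def)
  have r: "r \<noteq> 0"
    by (simp add: r_def)
  have comb0: "u p = 0" if u: "(\<Sum>p\<in>P. fscale (u p) (v p)) = 0" and p: "p \<in> P" for u p
  proof -
    \<comment> \<open>Padding with zeros on and below the diagonal turns the combination into a
      \<open>kernel_sum\<close>; \<open>r\<close> absorbs the normalization.\<close>
    define c where "c i j = r * u (j, i) * of_bool (i < j)" for i j
    have "(\<Sum>p\<in>P. fscale (u p) (v p)) = (\<Sum>j\<in>{1..n}. \<Sum>i\<in>{1..<j}. fscale (u (j, i)) (e_vec n i j))"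
      by (simp add: P_def v_def sum.Sigma case_prod_unfold)
    also have "\<dots> = (\<Sum>j\<in>{1..n}. \<Sum>i\<in>{1..n}. fscale (c i j) (kernel_gen n inv_kernel i j))"
    proof (rule sum.cong [OF refl])
      fix j
      assume "j \<in> {1..n}"
      then have "{1..<j} \<subseteq> {1..n}"
        by auto
      moreover have "fscale (c i j) (kernel_gen n inv_kernel i j) = 0" if "i \<in> {1..n} - {1..<j}" for i
        using that by (simp add: c_def)
      moreover have "fscale (u (j, i)) (e_vec n i j) = fscale (c i j) (kernel_gen n inv_kernel i j)"
        if "i \<in> {1..<j}" for i
        using that by (simp add: c_def e_vec_eq r_def)
      ultimately show "(\<Sum>i\<in>{1..<j}. fscale (u (j, i)) (e_vec n i j))
          = (\<Sum>i\<in>{1..n}. fscale (c i j) (kernel_gen n inv_kernel i j))"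
        by (intro sum.mono_neutral_cong_left) auto
    qed
    also have "\<dots> = kernel_sum n inv_kernel c"
      unfolding kernel_sum_expand by (rule sum.swap)
    finally have "kernel_sum n inv_kernel c = 0"
      using u by simp
    then have "\<forall>i\<in>{1..n}. \<forall>j\<in>{1..n}. c i j = c j i"
      using kernel_sum_inv_eq_0_iff [OF assms] by blast
    moreover obtain i j where ij: "p = (j, i)" "1 \<le> i" "i < j" "j \<le> n"
      using p by (auto simp: P_def)
    ultimately have "c i j = c j i"
      by auto
    with ij r show ?thesis
      by (simp add: c_def)
  qed
  \<comment> \<open>Two equal vectors would give a vanishing combination with coefficients 1 and -1,
    against \<open>comb0\<close>.\<close>
  have inj: "inj_on v P"
  proof
    fix p q
    assume pq: "p \<in> P" "q \<in> P" "v p = v q"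
    show "p = q"
    proof (rule ccontr)
      assume "p \<noteq> q"
      define u where "u x = (if x = p then 1 else if x = q then - 1 else (0 :: complex))" for x
      have "(\<Sum>x\<in>P. fscale (u x) (v x)) = (\<Sum>x\<in>{p, q}. fscale (u x) (v x))"
        using pq by (intro sum.mono_neutral_right) (auto simp: u_def)
      also have "\<dots> = 0"
        using \<open>p \<noteq> q\<close> pq(3) by (simp add: u_def)
      finally have "u p = 0"
        using pq(1) by (rule comb0)
      then show False
        by (simp add: u_def)
    qed
  qed
  have "fvs.independent (v ` P)"
  proof (rule fvs.independent_if_scalars_zero)
    fix f x
    assume "(\<Sum>x\<in>v ` P. fscale (f x) x) = 0" "x \<in> v ` P"
    then show "f x = 0"
      using comb0 [of "f \<circ> v"] by (auto simp: sum.reindex [OF inj])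
  qed simp
  moreover have "H_space n = fvs.span (v ` P)"
    unfolding H_space_def by (rule arg_cong [where f = fvs.span]) (force simp: v_def P_def)
  ultimately have "fvs.dim (H_space n) = card (v ` P)"
    by (metis fvs.dim_span_eq_card_independent)
  also have "\<dots> = (\<Sum>j\<in>{1..n}. j - 1)"
    unfolding card_image [OF inj] by (simp add: P_def)
  also have "\<dots> = n * (n - 1) div 2"
  proof (induction n)
    case (Suc m)
    then show ?case
      by (cases m) auto
  qed simp
  finally show ?thesis .
qed

section \<open>The Young diagrams of one row and of the hooks of height two and three\<close>

text \<open>In a hook every column but the first is a single cell, and along the first row the
  column number is the cell number. So only the cells \<open>S\<close> of the first column may
  move.\<close>

lemma col_group_eq:
  assumes "S \<subseteq> {1..n}" "1 \<in> S" "\<And>k. k \<in> {1..n} \<Longrightarrow> col_of l k = (if k \<in> S then 1 else k)"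
  shows "col_group n l = {p. p permutes S}"
proof (intro equalityI subsetI)
  fix p
  assume "p \<in> col_group n l"
  then have p: "p permutes {1..n}" and col: "\<And>k. k \<in> {1..n} \<Longrightarrow> col_of l (p k) = col_of l k"
    by (auto simp: col_group_def Sn_def)
  have "p k = k" if "k \<in> {1..n} - S" for k
  proof -
    have "p k \<in> {1..n}" "k \<noteq> 1"
      using that assms(2) permutes_in_image [OF p] by auto
    then show ?thesis
      using col [of k] assms(3) [of k] assms(3) [of "p k"] that by (auto split: if_splits)
  qed
  with p show "p \<in> {p. p permutes S}"
    using permutes_superset by blast
next
  fix p
  assume "p \<in> {p. p permutes S}"
  then have p: "p permutes S"
    by simp
  have "p permutes {1..n}"
    using p assms(1) by (rule permutes_subset)
  moreover have "col_of l (p k) = col_of l k" if "k \<in> {1..n}" for k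
  proof (cases "k \<in> S")
    case True
    then have "p k \<in> S"
      by (simp add: permutes_in_image [OF p])
    with True that assms show ?thesis
      by auto
  next
    case False
    then show ?thesis
      by (simp add: permutes_not_in [OF p])
  qed
  ultimately show "p \<in> col_group n l"
    by (simp add: col_group_def Sn_def)
qed

text \<open>If \<open>\<tau>\<close> is a row element times a column element \<open>p\<close>, the
  row element is \<open>inv p \<circ> \<tau>\<close>. The sum is indexed by \<open>p\<close> because
  the column groups below have at most six elements.\<close>

lemma young_symmetrizer_apply:
  assumes "\<tau> \<in> Sn n"
  shows "young_symmetrizer n l \<tau>
    = (\<Sum>p\<in>col_group n l. of_int (sign p) * of_bool (inv p \<circ> \<tau> \<in> row_group n l))"
proof -
  have sub: "col_group n l \<subseteq> Sn n"
    by (auto simp: col_group_def)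
  have "young_symmetrizer n l \<tau> = (\<Sum>g\<in>Sn n. of_bool (g \<in> row_group n l) *
      (if \<tau> \<circ> inv g \<in> col_group n l then of_int (sign (\<tau> \<circ> inv g)) else 0))"
    using assms unfolding young_symmetrizer_def galg_mult_def perm_mult_comp
    by (simp add: of_bool_def)
  also have "\<dots> = (\<Sum>p\<in>Sn n. of_bool (inv p \<circ> \<tau> \<in> row_group n l) *
      (if p \<in> col_group n l then of_int (sign p) else 0))"
  proof (rule sum.reindex_bij_witness [where i = "\<lambda>p. inv p \<circ> \<tau>" and j = "\<lambda>g. \<tau> \<circ> inv g"])
    fix g
    assume g: "g \<in> Sn n"
    show *: "inv (\<tau> \<circ> inv g) \<circ> \<tau> = g"
      using g assms by (simp add: Sn_inv_comp comp_assoc)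
    show "\<tau> \<circ> inv g \<in> Sn n"
      using g assms by simp
    show "of_bool (inv (\<tau> \<circ> inv g) \<circ> \<tau> \<in> row_group n l) *
        (if \<tau> \<circ> inv g \<in> col_group n l then complex_of_int (sign (\<tau> \<circ> inv g)) else 0)
      = of_bool (g \<in> row_group n l) *
        (if \<tau> \<circ> inv g \<in> col_group n l then complex_of_int (sign (\<tau> \<circ> inv g)) else 0)"
      unfolding * ..
  next
    fix p
    assume p: "p \<in> Sn n"
    have "inv (inv p \<circ> \<tau>) = inv \<tau> \<circ> p"
      using Sn_inv_comp [OF inv_in_Sn [OF p] assms] by (simp add: Sn_inv_inv [OF p])
    then show "\<tau> \<circ> inv (inv p \<circ> \<tau>) = p"
      by (simp add: Sn_comp_inv [OF assms] flip: comp_assoc)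
    show "inv p \<circ> \<tau> \<in> Sn n"
      using p assms by simp
  qed
  also have "\<dots> = (\<Sum>p\<in>col_group n l. of_int (sign p) * of_bool (inv p \<circ> \<tau> \<in> row_group n l))"
    using sub by (intro sum.mono_neutral_cong_right) auto
  finally show ?thesis .
qed

lemma row_of_eqI:
  assumes "k \<le> sum_list (take (Suc r) l)" "\<And>s. s < r \<Longrightarrow> sum_list (take (Suc s) l) < k"
  shows "row_of l k = r"
  unfolding row_of_def
proof (rule Least_equality)
  show "r \<le> s" if "k \<le> sum_list (take (Suc s) l)" for s
    using assms(2) [of s] that by linarith
qed (rule assms(1))

lemma row_of_one_row: "k \<le> n \<Longrightarrow> row_of [n] k = 0"
  by (rule row_of_eqI) auto

lemma row_of_hook2: "k \<in> {1..n} \<Longrightarrow> row_of [n - 1, 1] k = (if k = n then 1 else 0)"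
  by (auto intro!: row_of_eqI)

lemma row_of_hook3:
  assumes n: "n \<ge> 3" and k: "k \<in> {1..n}"
  shows "row_of [n - 2, 1, 1] k = (if k = n then 2 else if k = n - 1 then 1 else 0)"
proof -
  consider "k = n" | "k = n - 1" | "k \<le> n - 2"
    using k by fastforce
  then show ?thesis
  proof cases
    case 1
    have "row_of [n - 2, 1, 1] k = 2"
    proof (rule row_of_eqI)
      show "sum_list (take (Suc s) [n - 2, 1, 1]) < k" if "s < 2" for s
        using that 1 n by (auto simp: take_Cons' less_2_cases_iff)
    qed (use 1 n in \<open>simp add: take_Cons'\<close>)
    with 1 show ?thesis
      by simp
  next
    case 2
    then have "row_of [n - 2, 1, 1] k = 1"
      using n by (intro row_of_eqI) (auto simp: take_Cons')
    with 2 n show ?thesis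
      by simp
  next
    case 3
    then have "row_of [n - 2, 1, 1] k = 0"
      by (intro row_of_eqI) auto
    moreover have "k \<noteq> n" "k \<noteq> n - 1"
      using 3 n by linarith+
    ultimately show ?thesis
      by simp
  qed
qed

text \<open>The row group is everything and the column group is trivial.\<close>

lemma young_symmetrizer_one_row:
  assumes "n \<ge> 1" "\<tau> \<in> Sn n"
  shows "young_symmetrizer n [n] \<tau> = 1"
proof -
  have "col_group n [n] = {p. p permutes {1}}"
    using assms(1) by (intro col_group_eq) (auto simp: col_of_def row_of_one_row)
  also have "\<dots> = {id}"
    by (auto simp: permutes_sing)
  finally have col: "col_group n [n] = {id}" .
  have "\<tau> k \<le> n" if "k \<in> {1..n}" for k
    using Sn_apply_in [OF assms(2), of k] that by simp
  then have "\<tau> \<in> row_group n [n]"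
    using assms by (simp add: row_group_def row_of_one_row)
  then show ?thesis
    by (simp add: young_symmetrizer_apply [OF assms(2)] col)
qed

text \<open>The cells numbered 1 and \<open>n\<close> form the first column of the diagram with rows
  \<open>n - 1\<close> and 1; this is their signed indicator.\<close>

definition std_weight :: "nat \<Rightarrow> nat \<Rightarrow> complex" where
  "std_weight n x = of_bool (x = n) - of_bool (x = 1)"

text \<open>The column group consists of \<open>id\<close> and the transposition of 1 and
  \<open>n\<close>, and \<open>inv p \<circ> \<tau>\<close> preserves rows iff it fixes
  \<open>n\<close>, the only cell of the second row. The two terms are the two indicators in
  \<open>std_weight\<close>.\<close>

lemma young_symmetrizer_hook2:
  assumes n: "n \<ge> 3" and \<tau>: "\<tau> \<in> Sn n"
  shows "young_symmetrizer n [n - 1, 1] \<tau> = std_weight n (\<tau> n)"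
proof -
  have "col_group n [n - 1, 1] = {p. p permutes {1, n}}"
    using n by (intro col_group_eq) (auto simp: col_of_def row_of_hook2 take_Cons')
  also have "\<dots> = {id, transpose 1 n}"
    by (auto simp: permutes_doubleton_iff)
  finally have col: "col_group n [n - 1, 1] = {id, transpose 1 n}" .
  have row: "inv p \<circ> \<tau> \<in> row_group n [n - 1, 1] \<longleftrightarrow> \<tau> n = p n" if p: "p \<in> Sn n" for p
  proof -
    define q where "q = inv p \<circ> \<tau>"
    have q: "q \<in> Sn n"
      using p \<tau> by (simp add: q_def)
    have nn: "n \<in> {1..n}"
      using n by simp
    have "row_of [n - 1, 1] (q k) = row_of [n - 1, 1] k \<longleftrightarrow> (q k = n \<longleftrightarrow> k = n)"
      if k: "k \<in> {1..n}" for k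
    proof -
      have "q k \<in> {1..n}"
        using k Sn_apply_in [OF q] by blast
      with k show ?thesis
        by (simp add: row_of_hook2 del: atLeastAtMost_iff)
    qed
    then have "q \<in> row_group n [n - 1, 1] \<longleftrightarrow> (\<forall>k\<in>{1..n}. q k = n \<longleftrightarrow> k = n)"
      using q unfolding row_group_def by blast
    also have "\<dots> \<longleftrightarrow> q n = n"
      using Sn_inj [OF q] nn by metis
    also have "\<dots> \<longleftrightarrow> \<tau> n = p n"
      using Sn_inv_apply [OF p] by (metis comp_apply q_def)
    finally show ?thesis
      by (simp add: q_def)
  qed
  have "id \<noteq> transpose 1 n"
    using n by (metis id_apply transpose_apply_first numeral_le_one_iff semiring_norm(70))
  moreover have "transpose 1 n \<in> Sn n"
    using n by (intro transpose_in_Sn) auto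
  ultimately have "young_symmetrizer n [n - 1, 1] \<tau>
      = (\<Sum>p\<in>{id, transpose 1 n}. of_int (sign p) * of_bool (\<tau> n = p n))"
    unfolding young_symmetrizer_apply [OF \<tau>] col by (intro sum.cong refl, subst row) auto
  with n \<open>id \<noteq> transpose 1 n\<close> show ?thesis
    by (simp add: std_weight_def sign_swap_id del: sum_mult_of_bool_eq)
qed

text \<open>For \<open>n \<ge> 3\<close> the value is 1 if \<open>x\<close> to \<open>y\<close> is a
  step of the cycle from 1 to \<open>n - 1\<close> to \<open>n\<close> and back to 1, and -1 for a
  step backwards.\<close>

definition alt_kernel :: "nat \<Rightarrow> nat \<Rightarrow> nat \<Rightarrow> complex" where
  "alt_kernel n x y = of_bool (x = n - 1 \<and> y = n) - of_bool (x = n \<and> y = n - 1)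
     + of_bool (x = n \<and> y = 1) - of_bool (x = 1 \<and> y = n)
     + of_bool (x = 1 \<and> y = n - 1) - of_bool (x = n - 1 \<and> y = 1)"

text \<open>Preserving rows means fixing the single cells \<open>n - 1\<close> and \<open>n\<close>.
  The column group permutes three points, so its elements are determined by their values at
  \<open>n - 1\<close> and \<open>n\<close>, and their six signs are those of
  \<open>alt_kernel\<close>.\<close>

lemma young_symmetrizer_hook3:
  assumes n: "n \<ge> 3" and \<tau>: "\<tau> \<in> Sn n"
  shows "young_symmetrizer n [n - 2, 1, 1] \<tau> = alt_kernel n (\<tau> (n - 1)) (\<tau> n)"
proof -
  have col: "col_group n [n - 2, 1, 1] = {p. p permutes (insert 1 {n - 1, n})}"
    using n by (intro col_group_eq) (auto simp: col_of_def row_of_hook3 take_Cons')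
  have row: "inv p \<circ> \<tau> \<in> row_group n [n - 2, 1, 1] \<longleftrightarrow> \<tau> (n - 1) = p (n - 1) \<and> \<tau> n = p n"
    if p: "p \<in> Sn n" for p
  proof -
    define q where "q = inv p \<circ> \<tau>"
    have q: "q \<in> Sn n"
      using p \<tau> by (simp add: q_def)
    have nn: "n \<in> {1..n}" "n - 1 \<in> {1..n}" "n - 1 \<noteq> n"
      using n by auto
    have "row_of [n - 2, 1, 1] (q k) = row_of [n - 2, 1, 1] k
        \<longleftrightarrow> (q k = n \<longleftrightarrow> k = n) \<and> (q k = n - 1 \<longleftrightarrow> k = n - 1)" if k: "k \<in> {1..n}" for k
    proof -
      have "q k \<in> {1..n}"
        using k Sn_apply_in [OF q] by blast
      with k nn(3) show ?thesis
        by (simp add: row_of_hook3 [OF n] del: atLeastAtMost_iff)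
    qed
    then have "q \<in> row_group n [n - 2, 1, 1]
        \<longleftrightarrow> (\<forall>k\<in>{1..n}. (q k = n \<longleftrightarrow> k = n) \<and> (q k = n - 1 \<longleftrightarrow> k = n - 1))"
      using q unfolding row_group_def by blast
    also have "\<dots> \<longleftrightarrow> q (n - 1) = n - 1 \<and> q n = n"
      using Sn_inj [OF q] nn by metis
    also have "\<dots> \<longleftrightarrow> \<tau> (n - 1) = p (n - 1) \<and> \<tau> n = p n"
      using Sn_inv_apply [OF p] by (metis comp_apply q_def)
    finally show ?thesis
      by (simp add: q_def)
  qed
  have distinct: "1 \<noteq> n" "1 \<noteq> n - 1" "n - 1 \<noteq> n" "n \<noteq> 1" "n - 1 \<noteq> 1" "n \<noteq> n - 1"
    using n by auto
  have sub: "insert 1 {n - 1, n} \<subseteq> {1..n}"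
    using n by auto
  define f where "f p = (of_int (sign p) * of_bool (\<tau> (n - 1) = p (n - 1) \<and> \<tau> n = p n) :: complex)"
    for p :: "nat \<Rightarrow> nat"
  define t where "t = transpose (n - 1) n"
  have "id \<noteq> t"
    using distinct(3) unfolding t_def by (metis id_apply transpose_apply_first)
  have "young_symmetrizer n [n - 2, 1, 1] \<tau> = (\<Sum>p | p permutes insert 1 {n - 1, n}. f p)"
    unfolding young_symmetrizer_apply [OF \<tau>] col f_def
    by (intro sum.cong refl, subst row) (auto simp: Sn_def intro: permutes_subset [OF _ sub])
  \<comment> \<open>The six column permutations are a permutation of \<open>n - 1\<close> and
    \<open>n\<close> followed by the transposition of 1 and \<open>b\<close>, which is the identity
    for \<open>b = 1\<close>.\<close>
  also have "\<dots> = (\<Sum>b\<in>insert 1 {n - 1, n}. \<Sum>q | q permutes {n - 1, n}. f (transpose 1 b \<circ> q))"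
    by (subst sum_over_permutations_insert) (use distinct in auto)
  also have "{q. q permutes {n - 1, n}} = {id, t}"
    by (auto simp: permutes_doubleton_iff t_def)
  also have "(\<Sum>b\<in>insert 1 {n - 1, n}. \<Sum>q\<in>{id, t}. f (transpose 1 b \<circ> q))
      = f id + f t + (f (transpose 1 (n - 1)) + f (transpose 1 (n - 1) \<circ> t))
        + (f (transpose 1 n) + f (transpose 1 n \<circ> t))"
    using distinct \<open>id \<noteq> t\<close> by simp
  also have "f id = of_bool (\<tau> (n - 1) = n - 1 \<and> \<tau> n = n)"
    by (simp add: f_def)
  also have "f t = - of_bool (\<tau> (n - 1) = n \<and> \<tau> n = n - 1)"
    using distinct by (simp add: f_def t_def sign_swap_id)
  also have "f (transpose 1 (n - 1)) = - of_bool (\<tau> (n - 1) = 1 \<and> \<tau> n = n)"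
    using distinct by (simp add: f_def sign_swap_id)
  also have "f (transpose 1 (n - 1) \<circ> t) = of_bool (\<tau> (n - 1) = n \<and> \<tau> n = 1)"
    using distinct by (simp add: f_def t_def sign_compose sign_swap_id permutation_swap_id)
  also have "f (transpose 1 n) = - of_bool (\<tau> (n - 1) = n - 1 \<and> \<tau> n = 1)"
    using distinct by (simp add: f_def sign_swap_id)
  also have "f (transpose 1 n \<circ> t) = of_bool (\<tau> (n - 1) = 1 \<and> \<tau> n = n - 1)"
    using distinct by (simp add: f_def t_def sign_compose sign_swap_id permutation_swap_id)
  finally show ?thesis
    by (simp add: alt_kernel_def)
qed

section \<open>The two hook ideals as ranges of kernels\<close>

definition std_kernel :: "nat \<Rightarrow> nat \<Rightarrow> nat \<Rightarrow> complex" where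
  "std_kernel n x y = std_weight n x - std_weight n y"

lemma std_kernel_antisym: "std_kernel n x y = - std_kernel n y x"
  by (simp add: std_kernel_def)

lemma alt_kernel_antisym: "alt_kernel n x y = - alt_kernel n y x"
  by (simp add: alt_kernel_def conj_commute)

lemma sum_std_weight:
  assumes "n \<ge> 1" "\<sigma> \<in> Sn n"
  shows "(\<Sum>j\<in>{1..n}. std_weight n (\<sigma> j)) = 0"
proof -
  have "(\<Sum>j\<in>{1..n}. std_weight n (\<sigma> j)) = (\<Sum>j\<in>{1..n}. std_weight n j)"
    by (rule sum_Sn_reindex [OF assms(2)])
  with assms(1) show ?thesis
    by (simp add: std_weight_def sum_subtractf of_bool_def)
qed

text \<open>A permutation only reorders the sum over the second argument, and for every
  \<open>x\<close> the positive and negative entries of the kernel cancel.\<close>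

lemma sum_alt_kernel:
  assumes "n \<ge> 3" "\<sigma> \<in> Sn n"
  shows "(\<Sum>j\<in>{1..n}. alt_kernel n x (\<sigma> j)) = 0"
proof -
  have m: "1 \<in> {1..n}" "n - 1 \<in> {1..n}" "n \<in> {1..n}"
    using assms(1) by auto
  have delta: "(\<Sum>y\<in>{1..n}. of_bool (P \<and> y = z)) = (of_bool P :: complex)" if "z \<in> {1..n}" for P z
    using that by (simp add: of_bool_def flip: if_if_eq_conj)
  have "(\<Sum>j\<in>{1..n}. alt_kernel n x (\<sigma> j)) = (\<Sum>y\<in>{1..n}. alt_kernel n x y)"
    by (rule sum_Sn_reindex [OF assms(2)])
  also have "\<dots> = 0"
    unfolding alt_kernel_def sum_subtractf sum.distrib delta [OF m(1)] delta [OF m(2)] delta [OF m(3)]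
    by simp
  finally show ?thesis .
qed

lemma young_rep_one_row:
  assumes "n \<ge> 1"
  shows "young_rep n [n] = subrep (left_regular n) (fvs.span {one_vec n})"
proof -
  have "(\<lambda>g. galg_of n (\<lambda>\<sigma>. young_symmetrizer n [n] (\<sigma> \<circ> inv g))) ` Sn n = (\<lambda>g. one_vec n) ` Sn n"
    using assms by (intro image_cong refl) (simp add: galg_of_eq_iff young_symmetrizer_one_row)
  also have "\<dots> = {one_vec n}"
    using id_in_Sn by blast
  finally show ?thesis
    by (simp add: young_rep_def left_ideal_eq_span)
qed

text \<open>The translates of the symmetrizer are the weights \<open>w k\<close> at single
  positions, and the generators are the differences \<open>w a - w b\<close>. Conversely, the
  weights sum to zero, so summing \<open>w k - w j\<close> over \<open>j\<close> gives
  \<open>n\<close> times \<open>w k\<close>.\<close>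

lemma young_rep_hook2:
  assumes n: "n \<ge> 3"
  shows "young_rep n [n - 1, 1] = subrep (left_regular n) (range (kernel_sum n (std_kernel n)))"
proof -
  define w where "w k = galg_of n (\<lambda>\<sigma>. std_weight n (\<sigma> k))" for k
  have translates: "(\<lambda>g. galg_of n (\<lambda>\<sigma>. young_symmetrizer n [n - 1, 1] (\<sigma> \<circ> inv g))) ` Sn n
      = (\<lambda>g. w (inv g n)) ` Sn n"
    using n by (intro image_cong refl) (simp add: galg_of_eq_iff young_symmetrizer_hook2 w_def)
  have all: "(\<lambda>g. w (inv g n)) ` Sn n = w ` {1..n}"
  proof (intro equalityI subsetI)
    fix x
    assume "x \<in> (\<lambda>g. w (inv g n)) ` Sn n"
    then obtain g where g: "g \<in> Sn n" "x = w (inv g n)"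
      by auto
    have "inv g n \<in> {1..n}"
      unfolding Sn_apply_in [OF inv_in_Sn [OF g(1)]] using n by simp
    with g(2) show "x \<in> w ` {1..n}"
      by (rule image_eqI)
  next
    fix x
    assume "x \<in> w ` {1..n}"
    then obtain k where k: "k \<in> {1..n}" "x = w k"
      by auto
    have "transpose k n \<in> Sn n"
      using k n by simp
    moreover have "inv (transpose k n) n = k"
      by simp
    ultimately show "x \<in> (\<lambda>g. w (inv g n)) ` Sn n"
      using k(2) image_eqI [of x "\<lambda>g. w (inv g n)" "transpose k n"] by simp
  qed
  have "fvs.span (w ` {1..n}) = range (kernel_sum n (std_kernel n))"
  proof
    show "fvs.span (w ` {1..n}) \<subseteq> range (kernel_sum n (std_kernel n))"
    proof (rule fvs.span_minimal [OF _ subspace_range_kernel_sum], rule image_subsetI)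
      fix k
      assume k: "k \<in> {1..n}"
      have "(\<Sum>j\<in>{1..n}. std_kernel n (\<sigma> k) (\<sigma> j)) = of_nat n * std_weight n (\<sigma> k)"
        if "\<sigma> \<in> Sn n" for \<sigma>
        using n sum_std_weight [OF _ that] by (simp add: std_kernel_def sum_subtractf)
      then have "w k = fscale (1 / of_nat n) (\<Sum>j\<in>{1..n}. kernel_gen n (std_kernel n) k j)"
        using n by (simp add: w_def kernel_gen_def galg_of_sum galg_of_scale galg_of_eq_iff)
      also have "\<dots> \<in> range (kernel_sum n (std_kernel n))"
        by (intro fvs.subspace_scale fvs.subspace_sum subspace_range_kernel_sum kernel_gen_in_range k)
      finally show "w k \<in> range (kernel_sum n (std_kernel n))" .
    qed
    show "range (kernel_sum n (std_kernel n)) \<subseteq> fvs.span (w ` {1..n})"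
    proof (rule range_kernel_sum_subset [OF fvs.subspace_span])
      fix a b
      assume "a \<in> {1..n}" "b \<in> {1..n}"
      then have "w a - w b \<in> fvs.span (w ` {1..n})"
        by (intro fvs.span_diff fvs.span_base imageI)
      then show "kernel_gen n (std_kernel n) a b \<in> fvs.span (w ` {1..n})"
        by (simp add: w_def kernel_gen_def std_kernel_def galg_of_diff)
    qed
  qed
  then show ?thesis
    by (simp only: young_rep_def left_ideal_eq_span translates all)
qed

text \<open>The translates of the symmetrizer are themselves generators. By transitivity on pairs
  all distinct positions occur, and the diagonal generators vanish.\<close>

lemma young_rep_hook3:
  assumes n: "n \<ge> 3"
  shows "young_rep n [n - 2, 1, 1] = subrep (left_regular n) (range (kernel_sum n (alt_kernel n)))"
proof -
  let ?G = "\<lambda>a b. kernel_gen n (alt_kernel n) a b"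
  have nn: "n - 1 \<in> {1..n}" "n \<in> {1..n}" "n - 1 \<noteq> n"
    using n by auto
  have translates: "(\<lambda>g. galg_of n (\<lambda>\<sigma>. young_symmetrizer n [n - 2, 1, 1] (\<sigma> \<circ> inv g))) ` Sn n
      = (\<lambda>g. ?G (inv g (n - 1)) (inv g n)) ` Sn n"
    using n by (intro image_cong refl) (simp add: galg_of_eq_iff young_symmetrizer_hook3 kernel_gen_def)
  have "fvs.span ((\<lambda>g. ?G (inv g (n - 1)) (inv g n)) ` Sn n) = range (kernel_sum n (alt_kernel n))"
  proof
    have "?G (inv g (n - 1)) (inv g n) \<in> range (kernel_sum n (alt_kernel n))" if g: "g \<in> Sn n" for g
      by (intro kernel_gen_in_range) (simp_all only: Sn_apply_in [OF inv_in_Sn [OF g]] nn)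
    then show "fvs.span ((\<lambda>g. ?G (inv g (n - 1)) (inv g n)) ` Sn n) \<subseteq> range (kernel_sum n (alt_kernel n))"
      by (intro fvs.span_minimal [OF _ subspace_range_kernel_sum] image_subsetI)
    show "range (kernel_sum n (alt_kernel n)) \<subseteq> fvs.span ((\<lambda>g. ?G (inv g (n - 1)) (inv g n)) ` Sn n)"
    proof (rule range_kernel_sum_subset [OF fvs.subspace_span])
      fix a b
      assume ab: "a \<in> {1..n}" "b \<in> {1..n}"
      show "?G a b \<in> fvs.span ((\<lambda>g. ?G (inv g (n - 1)) (inv g n)) ` Sn n)"
      proof (cases "a = b")
        case True
        then have "?G a b = galg_of n (\<lambda>\<sigma>. 0)"
          unfolding kernel_gen_def galg_of_eq_iff using nn(3) n by (auto simp: alt_kernel_def)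
        then show ?thesis
          by (simp add: galg_of_zero fvs.span_zero)
      next
        case False
        then obtain h where "h \<in> Sn n" "h (n - 1) = a" "h n = b"
          using Sn_with_two_values [OF n nn(1,2) ab nn(3)] by blast
        then have "inv h \<in> Sn n" "?G a b = ?G (inv (inv h) (n - 1)) (inv (inv h) n)"
          by (simp_all add: Sn_inv_inv [OF \<open>h \<in> Sn n\<close>])
        then show ?thesis
          by (intro fvs.span_base) (rule image_eqI)
      qed
    qed
  qed
  then show ?thesis
    by (simp only: young_rep_def left_ideal_eq_span translates)
qed

section \<open>Irreducibility\<close>

lemma invariant_subspace_subrep:
  "V \<subseteq> galg n \<Longrightarrow> invariant_subspace n (subrep (left_regular n) V) U \<longleftrightarrow>
    U \<subseteq> V \<and> invariant_subspace n (left_regular n) U"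
  by (auto simp: invariant_subspace_def)

text \<open>Reduces both hooks to one task: recover every generator of \<open>V\<close> from a
  single nonzero vector.\<close>

lemma irreducible_repI:
  assumes "invariant_subspace n (left_regular n) V" "V \<noteq> {0}"
    and "\<And>U u. invariant_subspace n (left_regular n) U \<Longrightarrow> u \<in> U \<Longrightarrow> u \<in> V \<Longrightarrow> u \<noteq> 0 \<Longrightarrow> V \<subseteq> U"
  shows "irreducible_rep n (subrep (left_regular n) V)"
proof -
  have V: "V \<subseteq> galg n"
    using assms(1) by (simp add: invariant_subspace_def)
  have "U = {0} \<or> U = V" if U: "U \<subseteq> V" "invariant_subspace n (left_regular n) U" for U
  proof (cases "U = {0}")
    case False
    moreover have "0 \<in> U"
      using U by (simp add: invariant_subspace_def)
    ultimately obtain u where "u \<in> U" "u \<noteq> 0"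
      by blast
    then have "V \<subseteq> U"
      using assms(3) U by blast
    with U(1) show ?thesis
      by blast
  qed simp
  with assms V show ?thesis
    by (simp add: irreducible_rep_def invariant_subspace_subrep)
qed

lemma invariant_subspace_act:
  "invariant_subspace n (left_regular n) U \<Longrightarrow> g \<in> Sn n \<Longrightarrow> u \<in> U \<Longrightarrow> rep_act (left_regular n) g u \<in> U"
  by (simp add: invariant_subspace_def)

lemma kernel_gen_act:
  "g \<in> Sn n \<Longrightarrow>
    rep_act (left_regular n) g (kernel_gen n \<kappa> a b) = kernel_gen n \<kappa> (inv g a) (inv g b)"
  by (simp add: left_regular_act kernel_gen_def galg_of_eq_iff)

section \<open>Net flow and irreducibility for the hook of height two\<close>

definition flow :: "nat \<Rightarrow> (nat \<Rightarrow> nat \<Rightarrow> complex) \<Rightarrow> nat \<Rightarrow> complex" where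
  "flow n c i = (\<Sum>j\<in>{1..n}. c i j - c j i)"

text \<open>If \<open>c\<close> is read as a flow along directed edges, a kernel that is a
  difference of weights sees only the net flow out of each vertex.\<close>

lemma kernel_sum_std_eq_flow:
  assumes "\<sigma> \<in> Sn n"
  shows "kernel_sum n (std_kernel n) c \<sigma> = (\<Sum>i\<in>{1..n}. flow n c i * std_weight n (\<sigma> i))"
proof -
  have "kernel_sum n (std_kernel n) c \<sigma> = (\<Sum>i\<in>{1..n}. \<Sum>j\<in>{1..n}. c i j * std_weight n (\<sigma> i))
      - (\<Sum>i\<in>{1..n}. \<Sum>j\<in>{1..n}. c i j * std_weight n (\<sigma> j))"
    using assms by (simp add: kernel_sum_apply std_kernel_def right_diff_distrib sum_subtractf)
  also have "(\<Sum>i\<in>{1..n}. \<Sum>j\<in>{1..n}. c i j * std_weight n (\<sigma> j))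
      = (\<Sum>i\<in>{1..n}. \<Sum>j\<in>{1..n}. c j i * std_weight n (\<sigma> i))"
    by (rule sum.swap)
  finally show ?thesis
    by (simp add: flow_def sum_subtractf left_diff_distrib flip: sum_distrib_right)
qed

lemma kernel_sum_std_apply:
  assumes "n \<ge> 3" "\<sigma> \<in> Sn n" "i \<in> {1..n}" "j \<in> {1..n}" "\<sigma> i = n" "\<sigma> j = 1"
  shows "kernel_sum n (std_kernel n) c \<sigma> = flow n c i - flow n c j"
proof -
  have "std_weight n (\<sigma> k) = of_bool (k = i) - of_bool (k = j)" for k
    unfolding std_weight_def assms(5,6) [symmetric] by (simp only: Sn_inj [OF assms(2)])
  then have "kernel_sum n (std_kernel n) c \<sigma>
      = (\<Sum>k\<in>{1..n}. flow n c k * of_bool (k = i)) - (\<Sum>k\<in>{1..n}. flow n c k * of_bool (k = j))"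
    by (simp only: kernel_sum_std_eq_flow [OF assms(2)] right_diff_distrib sum_subtractf)
  also have "\<dots> = flow n c i - flow n c j"
    using assms(3,4) by (simp add: of_bool_def if_distrib del: sum_mult_of_bool_eq cong: if_cong)
  finally show ?thesis .
qed

lemma sum_flow: "(\<Sum>i\<in>{1..n}. flow n c i) = 0"
  unfolding flow_def sum_subtractf by (subst sum.swap) simp

lemma ex_Sn_values:
  assumes "n \<ge> 3" "\<sigma> \<in> Sn n" "x \<in> {1..n}"
  shows "\<exists>i\<in>{1..n}. \<sigma> i = x"
  using Sn_apply_in [OF inv_in_Sn [OF assms(2)], of x] Sn_inv_apply(2) [OF assms(2), of x] assms(3)
  by blast

text \<open>A point where \<open>u\<close> is nonzero exhibits positions \<open>i\<close>,
  \<open>j\<close> with different net flow. Subtracting from \<open>u\<close> its image under their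
  transposition leaves a nonzero multiple of the generator at \<open>i\<close>, \<open>j\<close>,
  and transitivity on pairs gives the others.\<close>

lemma irreducible_young_rep_hook2:
  assumes n: "n \<ge> 3"
  shows "irreducible_rep n (young_rep n [n - 1, 1])"
  unfolding young_rep_hook2 [OF n]
proof (rule irreducible_repI [OF invariant_range_kernel_sum])
  have n1: "1 \<in> {1..n}" "n \<in> {1..n}" "1 \<noteq> n"
    using n by auto
  have "kernel_gen n (std_kernel n) n 1 id \<noteq> 0"
    using n1 by (simp add: kernel_gen_def std_kernel_def std_weight_def)
  then have "kernel_gen n (std_kernel n) n 1 \<noteq> 0"
    by (metis zero_fun_apply)
  moreover have "kernel_gen n (std_kernel n) n 1 \<in> range (kernel_sum n (std_kernel n))"
    using n1 by (intro kernel_gen_in_range)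
  ultimately show "range (kernel_sum n (std_kernel n)) \<noteq> {0}"
    by blast
  fix U u
  assume U: "invariant_subspace n (left_regular n) U"
    and u: "u \<in> U" "u \<in> range (kernel_sum n (std_kernel n))" "u \<noteq> 0"
  note sub = invariant_subspace_imp_subspace [OF U]
  obtain c where c: "u = kernel_sum n (std_kernel n) c"
    using u(2) by blast
  obtain \<sigma> where "u \<sigma> \<noteq> 0"
    using u(3) by (auto simp: fun_eq_iff)
  then have "\<sigma> \<in> Sn n"
    by (auto simp: c kernel_sum_def galg_of_def split: if_splits)
  obtain i j where ij: "i \<in> {1..n}" "j \<in> {1..n}" "\<sigma> i = n" "\<sigma> j = 1"
    using ex_Sn_values [OF n \<open>\<sigma> \<in> Sn n\<close>] n1 by meson
  have diff: "flow n c i - flow n c j \<noteq> 0"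
    using \<open>u \<sigma> \<noteq> 0\<close> kernel_sum_std_apply [OF n \<open>\<sigma> \<in> Sn n\<close> ij] by (simp add: c)
  have "i \<noteq> j"
    using ij n1 by auto
  define t where "t = transpose i j"
  have t: "t \<in> Sn n"
    unfolding t_def using ij(1,2) by (rule transpose_in_Sn)
  have "u - rep_act (left_regular n) t u
      = fscale (flow n c i - flow n c j) (kernel_gen n (std_kernel n) i j)"
  proof -
    have "u \<tau> - u (\<tau> \<circ> inv t)
        = (flow n c i - flow n c j) * (std_weight n (\<tau> i) - std_weight n (\<tau> j))"
      if \<tau>: "\<tau> \<in> Sn n" for \<tau>
    proof -
      have "\<tau> \<circ> t \<in> Sn n"
        using \<tau> t by simp
      then have "u (\<tau> \<circ> inv t) = (\<Sum>k\<in>{1..n}. flow n c k * std_weight n (\<tau> (t k)))"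
        unfolding c t_def inv_transpose_eq by (subst kernel_sum_std_eq_flow) simp_all
      also have "\<dots> = (\<Sum>k\<in>{1..n}. flow n c (t k) * std_weight n (\<tau> k))"
        by (subst sum_Sn_reindex [OF t, symmetric]) (simp add: t_def)
      finally have "u \<tau> - u (\<tau> \<circ> inv t)
          = (\<Sum>k\<in>{1..n}. (flow n c k - flow n c (t k)) * std_weight n (\<tau> k))"
        unfolding c kernel_sum_std_eq_flow [OF \<tau>] by (simp add: left_diff_distrib sum_subtractf)
      \<comment> \<open>All other positions are fixed by \<open>t\<close>, so their flows
        cancel.\<close>
      also have "\<dots> = (\<Sum>k\<in>{i, j}. (flow n c k - flow n c (t k)) * std_weight n (\<tau> k))"
        using ij by (intro sum.mono_neutral_right) (auto simp: t_def transpose_def)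
      also have "\<dots> = (flow n c i - flow n c j) * (std_weight n (\<tau> i) - std_weight n (\<tau> j))"
        using \<open>i \<noteq> j\<close> by (simp add: t_def algebra_simps)
      finally show ?thesis .
    qed
    moreover have "u - rep_act (left_regular n) t u = galg_of n (\<lambda>\<tau>. u \<tau> - u (\<tau> \<circ> inv t))"
      unfolding left_regular_act [OF t] galg_of_diff [symmetric]
      using galg_of_id [of u n] by (simp add: c)
    ultimately show ?thesis
      by (simp add: kernel_gen_def galg_of_scale galg_of_eq_iff std_kernel_def)
  qed
  then have "fscale (flow n c i - flow n c j) (kernel_gen n (std_kernel n) i j) \<in> U"
    using fvs.subspace_diff [OF sub u(1) invariant_subspace_act [OF U t u(1)]] by simp
  then have "fscale (1 / (flow n c i - flow n c j))
      (fscale (flow n c i - flow n c j) (kernel_gen n (std_kernel n) i j)) \<in> U"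
    by (rule fvs.subspace_scale [OF sub])
  then have gen: "kernel_gen n (std_kernel n) i j \<in> U"
    using diff by simp
  show "range (kernel_sum n (std_kernel n)) \<subseteq> U"
  proof (rule range_kernel_sum_subset [OF sub])
    fix a b
    assume ab: "a \<in> {1..n}" "b \<in> {1..n}"
    show "kernel_gen n (std_kernel n) a b \<in> U"
    proof (cases "a = b")
      case True
      then show ?thesis
        using fvs.subspace_0 [OF sub] by (simp add: kernel_gen_def std_kernel_def galg_of_zero)
    next
      case False
      then obtain h where h: "h \<in> Sn n" "h i = a" "h j = b"
        using Sn_with_two_values [OF n ij(1,2) ab \<open>i \<noteq> j\<close>] by blast
      \<comment> \<open>The action applies the inverse to the positions of a generator, so
        \<open>inv h\<close> is what carries \<open>i\<close>, \<open>j\<close> to \<open>a\<close>,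
        \<open>b\<close>.\<close>
      then have "rep_act (left_regular n) (inv h) (kernel_gen n (std_kernel n) i j)
          = kernel_gen n (std_kernel n) a b"
        by (simp add: kernel_gen_act [OF inv_in_Sn [OF h(1)]] Sn_inv_inv [OF h(1)])
      then show ?thesis
        using invariant_subspace_act [OF U inv_in_Sn [OF h(1)] gen] by simp
    qed
  qed
qed

section \<open>Circulation around triangles and irreducibility for the hook of height three\<close>

definition curl :: "(nat \<Rightarrow> nat \<Rightarrow> complex) \<Rightarrow> nat \<Rightarrow> nat \<Rightarrow> nat \<Rightarrow> complex" where
  "curl c i j k = c i j - c j i + (c j k - c k j) + (c k i - c i k)"

text \<open>Evaluation at \<open>\<sigma>\<close> measures the circulation of \<open>c\<close>
  around the triangle of positions that carry 1, \<open>n - 1\<close> and \<open>n\<close>.\<close>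

lemma kernel_sum_alt_apply:
  assumes "\<sigma> \<in> Sn n" "i \<in> {1..n}" "j \<in> {1..n}" "k \<in> {1..n}" "\<sigma> i = 1" "\<sigma> j = n - 1" "\<sigma> k = n"
  shows "kernel_sum n (alt_kernel n) c \<sigma> = curl c i j k"
proof -
  have "\<sigma> a = 1 \<longleftrightarrow> a = i" "\<sigma> a = n - 1 \<longleftrightarrow> a = j" "\<sigma> a = n \<longleftrightarrow> a = k" for a
    using Sn_inj [OF assms(1)] assms(5-7) by metis+
  then have "kernel_sum n (alt_kernel n) c \<sigma> = (\<Sum>a\<in>{1..n}. \<Sum>b\<in>{1..n}. c a b *
      (of_bool (a = j \<and> b = k) - of_bool (a = k \<and> b = j) + of_bool (a = k \<and> b = i)
        - of_bool (a = i \<and> b = k) + of_bool (a = i \<and> b = j) - of_bool (a = j \<and> b = i)))"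
    by (simp only: kernel_sum_apply [OF assms(1)] alt_kernel_def)
  also have "\<dots> = c j k - c k j + c k i - c i k + c i j - c j i"
    unfolding right_diff_distrib distrib_left sum.distrib sum_subtractf
    by (simp only: sum_sum_delta [OF assms(2) assms(3)] sum_sum_delta [OF assms(3) assms(2)]
        sum_sum_delta [OF assms(2) assms(4)] sum_sum_delta [OF assms(4) assms(2)]
        sum_sum_delta [OF assms(4) assms(3)] sum_sum_delta [OF assms(3) assms(4)])
  finally show ?thesis
    by (simp add: curl_def)
qed

text \<open>Summing over the third vertex recovers an edge up to net flows, so flow and circulation
  together determine the antisymmetric part of \<open>c\<close>.\<close>

lemma sum_curl: "(\<Sum>k\<in>{1..n}. curl c i j k) = of_nat n * (c i j - c j i) + flow n c j - flow n c i"
  by (simp add: curl_def flow_def sum.distrib sum_subtractf algebra_simps)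

definition cyclic_coeff :: "nat \<Rightarrow> nat \<Rightarrow> nat \<Rightarrow> nat \<Rightarrow> nat \<Rightarrow> complex" where
  "cyclic_coeff i j k a b = of_bool (a = i \<and> b = j) - of_bool (a = j \<and> b = i)
     + of_bool (a = j \<and> b = k) - of_bool (a = k \<and> b = j)
     + of_bool (a = k \<and> b = i) - of_bool (a = i \<and> b = k)"

definition cyclic_gen :: "nat \<Rightarrow> nat \<Rightarrow> nat \<Rightarrow> nat \<Rightarrow> (nat \<Rightarrow> nat) \<Rightarrow> complex" where
  "cyclic_gen n i j k = kernel_gen n (alt_kernel n) i j + kernel_gen n (alt_kernel n) j k
     + kernel_gen n (alt_kernel n) k i"

lemma alt_gen_swap: "kernel_gen n (alt_kernel n) b a = - kernel_gen n (alt_kernel n) a b"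
proof
  fix \<sigma>
  show "kernel_gen n (alt_kernel n) b a \<sigma> = (- kernel_gen n (alt_kernel n) a b) \<sigma>"
    using alt_kernel_antisym [of n "\<sigma> b" "\<sigma> a"] by (simp add: kernel_gen_def galg_of_def)
qed

lemma alt_gen_self: "kernel_gen n (alt_kernel n) a a = 0"
  using alt_gen_swap [of n a a] by (auto simp: fun_eq_iff)

text \<open>The array lists each edge of the triangle in both directions with opposite signs;
  antisymmetry makes the two contributions equal, hence the factor 2.\<close>

lemma kernel_sum_cyclic_coeff:
  assumes "i \<in> {1..n}" "j \<in> {1..n}" "k \<in> {1..n}"
  shows "kernel_sum n (alt_kernel n) (cyclic_coeff i j k) = fscale 2 (cyclic_gen n i j k)"
proof -
  let ?G = "kernel_gen n (alt_kernel n)"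
  have "kernel_sum n (alt_kernel n) (cyclic_coeff i j k)
      = ?G i j - ?G j i + ?G j k - ?G k j + ?G k i - ?G i k"
    unfolding cyclic_coeff_def
    by (simp only: kernel_gen_eq_sum assms kernel_sum_add kernel_sum_diff)
  also have "\<dots> = fscale 2 (cyclic_gen n i j k)"
    using alt_gen_swap [of n j i] alt_gen_swap [of n k j] alt_gen_swap [of n i k]
    by (simp add: cyclic_gen_def fscale_def fun_eq_iff)
  finally show ?thesis .
qed

text \<open>
  Antisymmetrizing over the permutations of three points kills all coefficients except those
  at pairs of these points, and leaves there a multiple of the cyclic pattern.
\<close>

lemma antisymmetrized_coeff:
  assumes "distinct [i, j, k]"
  shows "c a b - c (transpose i j a) (transpose i j b) - c (transpose j k a) (transpose j k b)
      - c (transpose i k a) (transpose i k b)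
      + c (transpose i j (transpose j k a)) (transpose i j (transpose j k b))
      + c (transpose j k (transpose i j a)) (transpose j k (transpose i j b))
    = curl c i j k * cyclic_coeff i j k a b"
proof -
  have t: "transpose i j i = j" "transpose i j j = i" "transpose i j k = k"
    "transpose j k i = i" "transpose j k j = k" "transpose j k k = j"
    "transpose i k i = k" "transpose i k j = j" "transpose i k k = i"
    and t': "x \<noteq> i \<Longrightarrow> x \<noteq> j \<Longrightarrow> transpose i j x = x" "x \<noteq> j \<Longrightarrow> x \<noteq> k \<Longrightarrow> transpose j k x = x"
      "x \<noteq> i \<Longrightarrow> x \<noteq> k \<Longrightarrow> transpose i k x = x" for x
    using assms by (auto simp: transpose_def)
  \<comment> \<open>Each of \<open>a\<close> and \<open>b\<close> is one of the three points or
    outside them, which gives sixteen cases.\<close>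
  have cases4: "x = i \<or> x = j \<or> x = k \<or> (x \<noteq> i \<and> x \<noteq> j \<and> x \<noteq> k)" for x
    by blast
  have ne: "i \<noteq> j" "j \<noteq> i" "i \<noteq> k" "k \<noteq> i" "j \<noteq> k" "k \<noteq> j"
    using assms by auto
  show ?thesis
    using cases4 [of a] cases4 [of b]
    by (elim disjE) (simp_all add: t t' ne curl_def cyclic_coeff_def)
qed

text \<open>A nonzero \<open>u\<close> has a triangle with nonzero circulation, and antisymmetrizing
  over its vertices turns \<open>u\<close> into a nonzero multiple of the cyclic generator.
  Transitivity on triples reaches all triangles, and summing over the third vertex isolates a single
  generator.\<close>

lemma irreducible_young_rep_hook3:
  assumes n: "n \<ge> 3"
  shows "irreducible_rep n (young_rep n [n - 2, 1, 1])"
  unfolding young_rep_hook3 [OF n]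
proof (rule irreducible_repI [OF invariant_range_kernel_sum])
  let ?K = "kernel_sum n (alt_kernel n)"
  let ?act = "rep_act (left_regular n)"
  have nn: "1 \<in> {1..n}" "n - 1 \<in> {1..n}" "n \<in> {1..n}" "1 \<noteq> n - 1" "n - 1 \<noteq> n" "1 \<noteq> n"
    using n by auto
  have "kernel_gen n (alt_kernel n) (n - 1) n id \<noteq> 0"
    using nn(4-6) nn(4-6) [symmetric] by (simp add: kernel_gen_def alt_kernel_def)
  then have "kernel_gen n (alt_kernel n) (n - 1) n \<noteq> 0"
    by (metis zero_fun_apply)
  moreover have "kernel_gen n (alt_kernel n) (n - 1) n \<in> range ?K"
    using nn by (intro kernel_gen_in_range)
  ultimately show "range ?K \<noteq> {0}"
    by blast
  fix U u
  assume U: "invariant_subspace n (left_regular n) U"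
    and u: "u \<in> U" "u \<in> range ?K" "u \<noteq> 0"
  note sub = invariant_subspace_imp_subspace [OF U]
  obtain c where c: "u = ?K c"
    using u(2) by blast
  obtain \<sigma> where "u \<sigma> \<noteq> 0"
    using u(3) by (auto simp: fun_eq_iff)
  then have \<sigma>: "\<sigma> \<in> Sn n"
    by (auto simp: c kernel_sum_def galg_of_def split: if_splits)
  obtain i j k where ijk: "i \<in> {1..n}" "j \<in> {1..n}" "k \<in> {1..n}" "\<sigma> i = 1" "\<sigma> j = n - 1" "\<sigma> k = n"
    using ex_Sn_values [OF n \<sigma>] nn(1-3) by meson
  have curl: "curl c i j k \<noteq> 0"
    using \<open>u \<sigma> \<noteq> 0\<close> kernel_sum_alt_apply [OF \<sigma> ijk] by (simp add: c)
  have dist: "distinct [i, j, k]"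
    using ijk nn by auto
  \<comment> \<open>The signed sum over the six permutations of \<open>i\<close>, \<open>j\<close>,
    \<open>k\<close>: the transpositions are odd, the two 3-cycles even.\<close>
  define v where "v = u - ?act (transpose i j) u - ?act (transpose j k) u - ?act (transpose i k) u
    + ?act (transpose i j \<circ> transpose j k) u + ?act (transpose j k \<circ> transpose i j) u"
  note t = transpose_in_Sn [OF ijk(1,2)] transpose_in_Sn [OF ijk(2,3)] transpose_in_Sn [OF ijk(1,3)]
  note tt = comp_in_Sn [OF t(1,2)] comp_in_Sn [OF t(2,1)]
  have "v \<in> U"
    unfolding v_def
    by (intro fvs.subspace_add [OF sub] fvs.subspace_diff [OF sub] invariant_subspace_act [OF U] t tt u(1))
  moreover have "v = ?K (\<lambda>a b. curl c i j k * cyclic_coeff i j k a b)"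
    unfolding v_def c kernel_sum_act [OF t(1)] kernel_sum_act [OF t(2)] kernel_sum_act [OF t(3)]
      kernel_sum_act [OF tt(1)] kernel_sum_act [OF tt(2)] kernel_sum_add kernel_sum_diff
      antisymmetrized_coeff [OF dist, symmetric] comp_apply ..
  ultimately have "fscale (curl c i j k) (fscale 2 (cyclic_gen n i j k)) \<in> U"
    using kernel_sum_cyclic_coeff [OF ijk(1-3)] by (simp add: kernel_sum_scale [symmetric])
  then have "fscale (1 / (curl c i j k * 2)) (fscale (curl c i j k) (fscale 2 (cyclic_gen n i j k))) \<in> U"
    by (rule fvs.subspace_scale [OF sub])
  then have gen: "cyclic_gen n i j k \<in> U"
    using curl by simp
  have cyc: "cyclic_gen n a b d \<in> U" if abd: "a \<in> {1..n}" "b \<in> {1..n}" "d \<in> {1..n}" "a \<noteq> b" for a b d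
  proof (cases "d = a \<or> d = b")
    case True
    \<comment> \<open>A repeated vertex makes one edge diagonal and the other two opposite.\<close>
    then have "cyclic_gen n a b d = 0"
      using alt_gen_swap [of n b a] by (auto simp: cyclic_gen_def alt_gen_self)
    then show ?thesis
      using fvs.subspace_0 [OF sub] by simp
  next
    case False
    with abd have dist': "distinct [a, b, d]"
      by auto
    obtain h where h: "h \<in> Sn n" "h i = a" "h j = b" "h k = d"
      using Sn_with_three_values [OF ijk(1-3) abd(1-3) dist dist'] by blast
    have "?act (inv h) (cyclic_gen n i j k) = cyclic_gen n a b d"
      unfolding cyclic_gen_def kernel_gen_def galg_of_add left_regular_act [OF inv_in_Sn [OF h(1)]]
        galg_of_eq_iff
      using h by (simp add: Sn_inv_inv [OF h(1)])
    then show ?thesis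
      using invariant_subspace_act [OF U inv_in_Sn [OF h(1)] gen] by simp
  qed
  show "range ?K \<subseteq> U"
  proof (rule range_kernel_sum_subset [OF sub])
    fix a b
    assume ab: "a \<in> {1..n}" "b \<in> {1..n}"
    show "kernel_gen n (alt_kernel n) a b \<in> U"
    proof (cases "a = b")
      case True
      then show ?thesis
        using fvs.subspace_0 [OF sub] by (simp add: alt_gen_self)
    next
      case False
      have "(\<Sum>d\<in>{1..n}. alt_kernel n (\<tau> d) y) = 0" if "\<tau> \<in> Sn n" for \<tau> y
        using sum_alt_kernel [OF n that, of y] unfolding alt_kernel_antisym [of n _ y]
        by (simp add: sum_negf)
      \<comment> \<open>The two edges at \<open>d\<close> sum to zero over \<open>d\<close>, while
        the edge from \<open>a\<close> to \<open>b\<close> is counted \<open>n\<close>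
        times.\<close>
      then have "kernel_gen n (alt_kernel n) a b = fscale (1 / of_nat n) (\<Sum>d\<in>{1..n}. cyclic_gen n a b d)"
        using n by (simp add: cyclic_gen_def kernel_gen_def galg_of_add galg_of_sum galg_of_scale
            galg_of_eq_iff sum.distrib sum_alt_kernel)
      also have "\<dots> \<in> U"
        using ab False by (intro fvs.subspace_scale [OF sub] fvs.subspace_sum [OF sub] cyc)
      finally show ?thesis .
    qed
  qed
qed

section \<open>Decomposition of the span of the inversion functions\<close>

text \<open>The first vanishing sum makes the net flow constant, hence zero because its total is
  zero; the second makes all circulations zero. Then \<open>sum_curl\<close> leaves \<open>n\<close>
  times \<open>c i j - c j i\<close>.\<close>

lemma kernel_sum_std_alt_eq_0:
  assumes n: "n \<ge> 3" and std: "kernel_sum n (std_kernel n) c = 0"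
    and alt: "kernel_sum n (alt_kernel n) c = 0" and ij: "i \<in> {1..n}" "j \<in> {1..n}"
  shows "c i j = c j i"
proof -
  have nn: "1 \<in> {1..n}" "n - 1 \<in> {1..n}" "n \<in> {1..n}" "1 \<noteq> n - 1" "n - 1 \<noteq> n" "1 \<noteq> n"
    using n by auto
  have "flow n c a = flow n c b" if ab: "a \<in> {1..n}" "b \<in> {1..n}" for a b
  proof (cases "a = b")
    case False
    then obtain \<sigma> where \<sigma>: "\<sigma> \<in> Sn n" "\<sigma> a = n" "\<sigma> b = 1"
      using Sn_with_two_values [OF n ab nn(3,1)] nn(6) by metis
    then show ?thesis
      using kernel_sum_std_apply [OF n \<sigma>(1) ab \<sigma>(2,3), of c] std by simp
  qed simp
  then have "(\<Sum>b\<in>{1..n}. flow n c b) = (\<Sum>b\<in>{1..n}. flow n c a)" if "a \<in> {1..n}" for a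
    using that by (intro sum.cong refl)
  then have flow: "flow n c a = 0" if "a \<in> {1..n}" for a
    using that n unfolding sum_flow by fastforce
  have "curl c i j k = 0" if k: "k \<in> {1..n}" for k
  proof (cases "distinct [i, j, k]")
    case True
    moreover have "distinct [1, n - 1, n]"
      using nn by simp
    ultimately obtain \<sigma> where \<sigma>: "\<sigma> \<in> Sn n" "\<sigma> i = 1" "\<sigma> j = n - 1" "\<sigma> k = n"
      using Sn_with_three_values [OF ij k nn(1-3)] by blast
    then show ?thesis
      using kernel_sum_alt_apply [OF \<sigma>(1) ij k \<sigma>(2-4), of c] alt by simp
  qed (auto simp: curl_def)
  then have "of_nat n * (c i j - c j i) = 0"
    using sum_curl [of c i j n] flow ij by (simp del: atLeastAtMost_iff)
  with n show ?thesis
    by simp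
qed

text \<open>By linearity this concerns the difference of \<open>c\<close> and \<open>d\<close>:
  symmetric arrays are exactly those killed by the inversion kernel, and exactly those killed by the
  other two jointly. It will make the isomorphism well defined and injective.\<close>

lemma kernel_sum_inv_eq_iff:
  assumes n: "n \<ge> 3"
  shows "kernel_sum n inv_kernel c = kernel_sum n inv_kernel d \<longleftrightarrow>
    kernel_sum n (std_kernel n) c = kernel_sum n (std_kernel n) d \<and>
    kernel_sum n (alt_kernel n) c = kernel_sum n (alt_kernel n) d"
proof -
  let ?e = "\<lambda>i j. c i j - d i j"
  have "kernel_sum n inv_kernel ?e = 0 \<longleftrightarrow>
      kernel_sum n (std_kernel n) ?e = 0 \<and> kernel_sum n (alt_kernel n) ?e = 0"
  proof
    assume "kernel_sum n inv_kernel ?e = 0"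
    then have sym: "?e i j = ?e j i" if "i \<in> {1..n}" "j \<in> {1..n}" for i j
      using kernel_sum_inv_eq_0_iff [OF n, of ?e] that by blast
    show "kernel_sum n (std_kernel n) ?e = 0 \<and> kernel_sum n (alt_kernel n) ?e = 0"
      using std_kernel_antisym alt_kernel_antisym sym by (intro conjI kernel_sum_symmetric)
  next
    assume "kernel_sum n (std_kernel n) ?e = 0 \<and> kernel_sum n (alt_kernel n) ?e = 0"
    then have "?e i j = ?e j i" if "i \<in> {1..n}" "j \<in> {1..n}" for i j
      using kernel_sum_std_alt_eq_0 [OF n, of ?e i j] that by blast
    then show "kernel_sum n inv_kernel ?e = 0"
      using kernel_sum_inv_eq_0_iff [OF n, of ?e] by blast
  qed
  then show ?thesis
    by (simp flip: kernel_sum_diff)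
qed

text \<open>\<open>flow n c i / n\<close> are the coefficients of the projection of \<open>c\<close> to the standard component.\<close>

lemma std_projection:
  assumes n: "n \<ge> 3"
  defines "p c \<equiv> \<lambda>i j :: nat. flow n c i / of_nat n"
  shows "kernel_sum n (std_kernel n) (p c) = kernel_sum n (std_kernel n) c"
    and "kernel_sum n (alt_kernel n) (p c) = 0"
proof -
  have n1: "n \<ge> 1"
    using n by simp
  have "kernel_sum n (std_kernel n) (p c) \<sigma> = kernel_sum n (std_kernel n) c \<sigma>" if \<sigma>: "\<sigma> \<in> Sn n" for \<sigma>
  proof -
    have "kernel_sum n (std_kernel n) (p c) \<sigma>
        = (\<Sum>i\<in>{1..n}. flow n c i / of_nat n * (\<Sum>j\<in>{1..n}. std_kernel n (\<sigma> i) (\<sigma> j)))"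
      by (simp add: kernel_sum_apply [OF \<sigma>] p_def sum_distrib_left)
    also have "\<dots> = (\<Sum>i\<in>{1..n}. flow n c i * std_weight n (\<sigma> i))"
      using n sum_std_weight [OF n1 \<sigma>] by (simp add: std_kernel_def sum_subtractf)
    finally show ?thesis
      by (simp add: kernel_sum_std_eq_flow [OF \<sigma>])
  qed
  then show "kernel_sum n (std_kernel n) (p c) = kernel_sum n (std_kernel n) c"
    unfolding kernel_sum_def by (simp add: galg_of_eq_iff)
  \<comment> \<open>As \<open>p c i j\<close> does not depend on \<open>j\<close>, it factors out of
    the inner sums of \<open>alt_kernel\<close>, which vanish.\<close>
  have "(\<Sum>i\<in>{1..n}. \<Sum>j\<in>{1..n}. p c i j * alt_kernel n (\<sigma> i) (\<sigma> j)) = 0" if "\<sigma> \<in> Sn n" for \<sigma>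
    unfolding p_def sum_distrib_left [symmetric] sum_alt_kernel [OF n that] by simp
  then show "kernel_sum n (alt_kernel n) (p c) = 0"
    unfolding kernel_sum_def galg_of_zero [of n, symmetric] galg_of_eq_iff by blast
qed

lemma H_space_decomposition:
  assumes n: "n \<ge> 3"
  shows "rep_iso n (subrep (left_regular n) (H_space n))
    (rep_sum (young_rep n [n - 1, 1]) (young_rep n [n - 2, 1, 1]))"
proof -
  define S where "S = kernel_sum n (std_kernel n)"
  define A where "A = kernel_sum n (alt_kernel n)"
  define I where "I = kernel_sum n inv_kernel"
  \<comment> \<open>Any coefficient array representing \<open>f\<close> may be chosen;
    \<open>kernel_sum_inv_eq_iff\<close> shows that the pair does not depend on it.\<close>
  define T where "T f = (let c = SOME c. f = I c in (S c, A c))" for f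
  have T: "T (I c) = (S c, A c)" for c
  proof -
    have "I c = I (SOME d. I c = I d)"
      by (rule someI [of "\<lambda>d. I c = I d"]) (rule refl)
    then show ?thesis
      unfolding T_def Let_def I_def S_def A_def kernel_sum_inv_eq_iff [OF n] by simp
  qed
  have "bij_betw T (range I) (range S \<times> range A)"
  proof (rule bij_betw_imageI)
    show "inj_on T (range I)"
    proof (rule inj_onI)
      fix x y
      assume "x \<in> range I" "y \<in> range I" "T x = T y"
      then obtain c d where cd: "x = I c" "y = I d" "S c = S d" "A c = A d"
        by (auto simp: T)
      then have "I c = I d"
        unfolding I_def S_def A_def kernel_sum_inv_eq_iff [OF n] by blast
      with cd show "x = y"
        by simp
    qed
    show "T ` range I = range S \<times> range A"
    proof
      show "T ` range I \<subseteq> range S \<times> range A"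
        by (auto simp: T)
      show "range S \<times> range A \<subseteq> T ` range I"
      proof clarify
        fix c d
        define p where "p c = (\<lambda>i j :: nat. flow n c i / of_nat n)" for c
        \<comment> \<open>For surjectivity, \<open>p c\<close> supplies the standard component of
          \<open>c\<close> and nothing alternating, while \<open>d\<close> minus \<open>p d\<close>
          keeps only the alternating component of \<open>d\<close>.\<close>
        define e where "e = (\<lambda>i j. p c i j + (d i j - p d i j))"
        have "S e = S c" "A e = A d"
          unfolding e_def S_def A_def kernel_sum_add [symmetric] kernel_sum_diff [symmetric]
          using std_projection [OF n] by (simp_all add: p_def)
        then have "(S c, A d) = T (I e)"
          by (simp add: T)
        then show "(S c, A d) \<in> T ` range I"
          by blast
      qed
    qed
  qed
  moreover have "T (x + y) = T x + T y" if "x \<in> range I" "y \<in> range I" for x y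
    using that by (auto simp: I_def kernel_sum_add T [unfolded I_def])
      (simp_all add: S_def A_def kernel_sum_add)
  moreover have "T (fscale k x) = (fscale k (fst (T x)), fscale k (snd (T x)))" if "x \<in> range I" for x k
    using that by (auto simp: I_def kernel_sum_scale T [unfolded I_def])
      (simp_all add: S_def A_def kernel_sum_scale)
  moreover have "T (rep_act (left_regular n) g x)
      = (rep_act (left_regular n) g (fst (T x)), rep_act (left_regular n) g (snd (T x)))"
    if "g \<in> Sn n" "x \<in> range I" for x g
    using that by (auto simp: I_def kernel_sum_act T [unfolded I_def])
      (simp_all add: S_def A_def kernel_sum_act)
  ultimately show ?thesis
    unfolding rep_iso_def young_rep_hook2 [OF n] young_rep_hook3 [OF n] H_space_eq_range
      rep_sum_def I_def [symmetric] S_def [symmetric] A_def [symmetric]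
    by (intro exI [of _ T]) (simp add: case_prod_unfold)
qed

section \<open>Uniqueness of the identity subrepresentation\<close>

lemma one_vec_act: "g \<in> Sn n \<Longrightarrow> rep_act (left_regular n) g (one_vec n) = one_vec n"
  by (simp add: left_regular_act galg_of_eq_iff)

lemma act_scale:
  "g \<in> Sn n \<Longrightarrow> rep_act (left_regular n) g (fscale c f) = fscale c (rep_act (left_regular n) g f)"
  by (simp add: left_regular_act galg_of_scale) (simp add: fscale_def)

text \<open>The group fixes every vector of the ideal for one row, hence every vector of an
  isomorphic \<open>W\<close>. Fixed functions are constant, so \<open>W\<close> is a nonzero
  subspace of a line.\<close>

lemma trivial_subrep_unique:
  assumes n: "n \<ge> 1"
  shows "{W. invariant_subspace n (left_regular n) W \<and>
      rep_iso n (subrep (left_regular n) W) (young_rep n [n])} = {fvs.span {one_vec n}}"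
proof -
  let ?L = "fvs.span {one_vec n}"
  let ?act = "rep_act (left_regular n)"
  have L: "x \<in> ?L \<longleftrightarrow> (\<exists>c. x = fscale c (one_vec n))" for x
    by (auto simp: fvs.span_singleton)
  have act_L: "?act g x = x" if "g \<in> Sn n" "x \<in> ?L" for g x
    using that by (auto simp: L act_scale one_vec_act)
  have L_galg: "?L \<subseteq> galg n"
    by (auto simp: L galg_of_scale)
  have "invariant_subspace n (left_regular n) ?L"
    unfolding invariant_subspace_def using L_galg act_L
    by (auto intro: fvs.span_zero fvs.span_add fvs.span_scale)
  moreover have "rep_iso n (subrep (left_regular n) ?L) (young_rep n [n])"
    unfolding rep_iso_def young_rep_one_row [OF n] by (rule exI [of _ "\<lambda>x. x"]) (simp add: bij_betw_def)
  moreover have "W = ?L"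
    if W: "invariant_subspace n (left_regular n) W"
      and iso: "rep_iso n (subrep (left_regular n) W) (young_rep n [n])" for W
  proof -
    obtain T where T: "bij_betw T W ?L"
      "\<And>g x. g \<in> Sn n \<Longrightarrow> x \<in> W \<Longrightarrow> T (?act g x) = ?act g (T x)"
      using iso unfolding rep_iso_def young_rep_one_row [OF n] by auto
    have fixed: "?act g x = x" if gx: "g \<in> Sn n" "x \<in> W" for g x
    proof -
      have "T x \<in> ?L"
        using T(1) gx(2) by (rule bij_betw_apply)
      then have "T (?act g x) = T x"
        using T(2) gx act_L by simp
      then show ?thesis
        using T(1) gx invariant_subspace_act [OF W gx] by (meson bij_betw_imp_inj_on inj_onD)
    qed
    have sub: "W \<subseteq> ?L"
    proof
      fix x
      assume x: "x \<in> W"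
      then have "x \<in> galg n"
        using W by (auto simp: invariant_subspace_def)
      have "x \<sigma> = x id" if "\<sigma> \<in> Sn n" for \<sigma>
      proof -
        \<comment> \<open>Acting by \<open>\<sigma>\<close> and evaluating at
          \<open>\<sigma>\<close> itself reads off the value at the identity.\<close>
        have "x \<sigma> = ?act \<sigma> x \<sigma>"
          using fixed [OF that x] by simp
        also have "\<dots> = x id"
          using that by (simp add: left_regular_act)
        finally show ?thesis .
      qed
      then have "galg_of n x = fscale (x id) (one_vec n)"
        unfolding galg_of_scale galg_of_eq_iff mult_1_right by blast
      then have "x = fscale (x id) (one_vec n)"
        using galg_of_id [OF \<open>x \<in> galg n\<close>] by simp
      then show "x \<in> ?L"
        using L by blast
    qed
    have "W \<noteq> {0}"
    proof
      assume "W = {0}"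
      then have "?L = {T 0}"
        using T(1) by (simp add: bij_betw_def)
      then have "one_vec n = 0"
        using fvs.span_base [of "one_vec n" "{one_vec n}"] fvs.span_zero [of "{one_vec n}"]
        by (metis singletonD singletonI)
      then show False
        using one_vec_nonzero by blast
    qed
    moreover have "0 \<in> W"
      using W by (simp add: invariant_subspace_def)
    ultimately obtain x where "x \<in> W" "x \<noteq> 0"
      by blast
    with sub L obtain c where c: "fscale c (one_vec n) \<in> W" "c \<noteq> 0"
      by fastforce
    have "one_vec n = fscale (1 / c) (fscale c (one_vec n))"
      using c(2) by simp
    also have "\<dots> \<in> W"
      using c(1) by (rule fvs.subspace_scale [OF invariant_subspace_imp_subspace [OF W]])
    finally have "one_vec n \<in> W" .
    then have "?L \<subseteq> W"
      by (intro fvs.span_minimal invariant_subspace_imp_subspace [OF W]) simp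
    with sub show ?thesis
      by blast
  qed
  ultimately show ?thesis
    by blast
qed

lemma dim_one_vec: "fvs.dim {one_vec n} = 1"
  using fvs.dim_eq_card_independent [of "{one_vec n}"] one_vec_nonzero by simp

lemma real_sum_Icc: "real (\<Sum>i\<in>{1..m}. i) = real m * (real m + 1) / 2"
  by (induction m) (auto simp: field_simps)

theorem theorem4:
  fixes n :: nat
    and s0_maj s1_maj s0_des s1_des :: real
  assumes "n \<ge> 3"
    and "s0_maj = fact n * (real n * (real n - 1) / 4)"
    and "s1_maj = - (fact n / 2)"
    and "s0_des = fact n * ((real n - 1) / 2)"
    and "s1_des = - fact (n - 1)"
  shows
    "(\<forall>(\<epsilon>, s0, s1) \<in> {(maj n, s0_maj, s1_maj), (des n, s0_des, s1_des)}.
        s0 > 0 \<and> s1 < 0 \<and>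
        {s. is_eigenvalue n (M_op n \<epsilon>) s \<and> s \<noteq> 0} = {complex_of_real s0, complex_of_real s1} \<and>
        fvs.dim (eigenspace n (M_op n \<epsilon>) s0) = 1 \<and>
        eigenspace n (M_op n \<epsilon>) s0 = fvs.span {galg_of n (\<lambda>\<sigma>. 1)} \<and>
        {W. invariant_subspace n (left_regular n) W \<and>
            rep_iso n (subrep (left_regular n) W) (young_rep n [n])}
          = {eigenspace n (M_op n \<epsilon>) s0} \<and>
        fvs.dim (eigenspace n (M_op n \<epsilon>) s1) = n * (n - 1) div 2 \<and>
        eigenspace n (M_op n \<epsilon>) s1 = H_space n \<and>
        invariant_subspace n (left_regular n) (eigenspace n (M_op n \<epsilon>) s1) \<and>
        rep_iso n (subrep (left_regular n) (eigenspace n (M_op n \<epsilon>) s1))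
          (rep_sum (young_rep n [n - 1, 1]) (young_rep n [n - 2, 1, 1]))) \<and>
     eigenspace n (M_op n (maj n)) s0_maj = eigenspace n (M_op n (des n)) s0_des \<and>
     eigenspace n (M_op n (maj n)) s1_maj = eigenspace n (M_op n (des n)) s1_des \<and>
     irreducible_rep n (young_rep n [n - 1, 1]) \<and>
     irreducible_rep n (young_rep n [n - 2, 1, 1])"
proof -
  note n = assms(1)
  have n1: "n \<ge> 1"
    using n by simp
  have "n = Suc (Suc (n - 2))"
    using n by simp
  then obtain m where m: "n = Suc (Suc m)"
    by blast
  \<comment> \<open>The total weights of \<open>maj\<close> and \<open>des\<close>, which are the
    only data on which the two cases differ.\<close>
  define Km where "Km = (\<Sum>i\<in>{1..n - 1}. i)"
  define Kd where "Kd = (\<Sum>i\<in>{1..n - 1}. 1 :: nat)"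
  have Km: "real Km = real n * (real n - 1) / 2"
    using n unfolding Km_def real_sum_Icc by (simp add: of_nat_diff)
  have Kd: "real Kd = real n - 1"
    using n by (simp add: Kd_def of_nat_diff)
  have fact1: "fact (n - 1) = (real n - 1) * fact (n - 2)" and fact0: "fact n = real n * fact (n - 1)"
    by (simp_all add: m)
  have pos: "real Km > 0" "real Kd > 0"
    using n unfolding Km Kd by simp_all
  \<comment> \<open>The stated values of \<open>s1\<close> come from
    \<open>n * (n - 1) * fact (n - 2) = fact n\<close> for \<open>maj\<close> and
    \<open>(n - 1) * fact (n - 2) = fact (n - 1)\<close> for \<open>des\<close>.\<close>
  have eqs: "s0_maj = fact n * real Km / 2" "s1_maj = - (fact (n - 2) * real Km)"
    "s0_des = fact n * real Kd / 2" "s1_des = - (fact (n - 2) * real Kd)"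
    unfolding assms Km Kd fact0 fact1 by (simp_all add: field_simps)
  have signs: "s0_maj > 0" "s1_maj < 0" "s0_des > 0" "s1_des < 0"
    using pos by (simp_all add: eqs)
  have c_eqs: "complex_of_real s0_maj = fact n * of_nat Km / 2"
    "complex_of_real s1_maj = - (fact (n - 2) * of_nat Km)"
    "complex_of_real s0_des = fact n * of_nat Kd / 2"
    "complex_of_real s1_des = - (fact (n - 2) * of_nat Kd)"
    by (simp_all add: eqs)
  have posn: "Km > 0" "Kd > 0"
    using pos by simp_all
  note maj = eigenspaces_desc_stat [OF n posn(1) [unfolded Km_def], folded Km_def maj_eq_desc_stat, folded c_eqs]
  note des = eigenspaces_desc_stat [OF n posn(2) [unfolded Kd_def], folded Kd_def des_eq_desc_stat, folded c_eqs]
  have H: "invariant_subspace n (left_regular n) (H_space n)"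
    unfolding H_space_eq_range by (rule invariant_range_kernel_sum)
  show ?thesis
    using signs H
    by (simp add: maj des dim_one_vec trivial_subrep_unique [OF n1] dim_H_space [OF n]
        H_space_decomposition [OF n] irreducible_young_rep_hook2 [OF n] irreducible_young_rep_hook3 [OF n])
qed

end
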